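(* Call a triple $(n,m,k)$ of positive integers admissible if $\gcd(n,m)=1$, $m\ne 1$, $\frac nm>1$, and one of the following holds: (i) $k=1$, $n\mid (m-1)^2$ and $(m-1)\mid n$; (ii) $k=2$, $m\equiv 9 \pmod{16}$ and $n=\frac{1}{16}(m-1)^2$; (iii) $k=3$, and either ($m\equiv 10$ or $m\equiv 19 \pmod{27}$, and $n=\frac{1}{27}(m-1)^2$) or $\frac nm=\frac{12}{7}$. For each admissible triple $(n,m,k)$, put $l=\gcd(n,m-1)$; then for a suitable constant $f$ the polynomial $$p_{n,m,k}(x,y)=\frac{n}{2}\left(x-\frac{m-1}{n}y\right)^2+\left(1-\frac{kl}{2}\right)x+\frac{2(1-m)+kl(m+1)}{2n}y+f$$ is a packing polynomial on $S(n/m)$. Up to equivalence, these polynomials $p_{n,m,k}$ on the sectors $S(n/m)$ for admissible triples $(n,m,k)$, together with the polynomials $$f_n(x,y)=\frac n2x^2+\left(1-\frac n2\right)x+y,\qquad g_n(x,y)=\frac n2x^2+\left(1+\frac n2\right)x-y$$ on $S(n)$ for integers $n\ge 1$, represent all quadratic packing polynomials on rational sectors.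
   Context: $\mathbb{N}=\{0,1,2,\dots\}$. For real $\alpha\ge 0$, $S(\alpha)=\{(x,y)\in\mathbb{R}^2 : x,y\ge 0,\ y\le \alpha x\}$ and $I(\alpha)=S(\alpha)\cap\mathbb{Z}^2$; $S(\alpha)$ is called a rational sector if $\alpha$ is rational. A real polynomial $p(x,y)$ is a packing polynomial on $S(\alpha)$ if $p|_{I(\alpha)}$ is a bijection from $I(\alpha)$ to $\mathbb{N}$. It is quadratic if it has total degree 2. A packing polynomial $p$ on $S(\alpha)$ and a packing polynomial $q$ on $S(\beta)$ are equivalent if there is a linear map $T$ that restricts to a bijection from $I(\alpha)$ to $I(\beta)$ such that $p=q\circ T$.
   Formalization: Two representatives are missing from the list and are added: (3/2)x²−(7/2)x+3y+2 on S(3) and 2x²−3x+2y+1 on S(4). The completeness claim is for α>0, as it fails on S(0), where x+y² is a quadratic packing polynomial equivalent to none listed. *)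

theory Defs
  imports
    "HOL-Analysis.Analysis"
    "HOL-Computational_Algebra.Polynomial"
    "HOL-Number_Theory.Cong"
begin

definition sector :: "real \<Rightarrow> (real \<times> real) set" where
  "sector \<alpha> = {(x, y). 0 \<le> x \<and> 0 \<le> y \<and> y \<le> \<alpha> * x}"

definition sector_lattice :: "real \<Rightarrow> (real \<times> real) set" where
  "sector_lattice \<alpha> = sector \<alpha> \<inter> (\<int> \<times> \<int>)"

(* Real polynomials in two variables: the outer variable is y, and the coefficients
   are polynomials in x.  Thus coeff (coeff p j) i is the coefficient of x^i y^j. *)
type_synonym poly2 = "real poly poly"

definition eval2 :: "poly2 \<Rightarrow> real \<times> real \<Rightarrow> real" where
  "eval2 p v = poly (poly p [:snd v:]) (fst v)"

definition varX :: poly2 where "varX = [:[:0, 1:]:]"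
definition varY :: poly2 where "varY = [:0, 1:]"
definition const2 :: "real \<Rightarrow> poly2" where "const2 c = [:[:c:]:]"

(* As for degree, the zero polynomial gets total degree 0. *)
definition total_degree2 :: "poly2 \<Rightarrow> nat" where
  "total_degree2 p = Max (insert 0 {i + j | i j. coeff (coeff p j) i \<noteq> 0})"

definition packing_polynomial :: "real \<Rightarrow> poly2 \<Rightarrow> bool" where
  "packing_polynomial \<alpha> p \<longleftrightarrow> bij_betw (eval2 p) (sector_lattice \<alpha>) \<nat>"

definition quadratic_packing_polynomial :: "real \<Rightarrow> poly2 \<Rightarrow> bool" where
  "quadratic_packing_polynomial \<alpha> p \<longleftrightarrow> packing_polynomial \<alpha> p \<and> total_degree2 p = 2"

definition packing_equivalent :: "real \<Rightarrow> poly2 \<Rightarrow> real \<Rightarrow> poly2 \<Rightarrow> bool" where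
  "packing_equivalent \<alpha> p \<beta> q \<longleftrightarrow>
     packing_polynomial \<alpha> p \<and> packing_polynomial \<beta> q \<and>
     (\<exists>T. linear T \<and> bij_betw T (sector_lattice \<alpha>) (sector_lattice \<beta>) \<and>
          eval2 p = eval2 q \<circ> T)"

definition admissible :: "nat \<Rightarrow> nat \<Rightarrow> nat \<Rightarrow> bool" where
  "admissible n m k \<longleftrightarrow>
     0 < n \<and> 0 < m \<and> 0 < k \<and>
     gcd n m = 1 \<and> m \<noteq> 1 \<and> real n / real m > 1 \<and>
     ((k = 1 \<and> n dvd (m - 1)\<^sup>2 \<and> (m - 1) dvd n) \<or>
      (k = 2 \<and> [m = 9] (mod 16) \<and> real n = 1 / 16 * (real m - 1)\<^sup>2) \<or>
      (k = 3 \<and> ((([m = 10] (mod 27) \<or> [m = 19] (mod 27)) \<and> real n = 1 / 27 * (real m - 1)\<^sup>2) \<or>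
                real n / real m = 12 / 7)))"

definition p_poly :: "nat \<Rightarrow> nat \<Rightarrow> nat \<Rightarrow> real \<Rightarrow> poly2" where
  "p_poly n m k f =
     (let l = real (gcd n (m - 1)) in
        const2 (real n / 2) * (varX - const2 ((real m - 1) / real n) * varY)\<^sup>2
        + const2 (1 - real k * l / 2) * varX
        + const2 ((2 * (1 - real m) + real k * l * (real m + 1)) / (2 * real n)) * varY
        + const2 f)"

definition f_poly :: "nat \<Rightarrow> poly2" where
  "f_poly n = const2 (real n / 2) * varX\<^sup>2 + const2 (1 - real n / 2) * varX + varY"

definition g_poly :: "nat \<Rightarrow> poly2" where
  "g_poly n = const2 (real n / 2) * varX\<^sup>2 + const2 (1 + real n / 2) * varX - varY"

(* The sectors S(3) and S(4) carry one further class of quadratic packing polynomials each,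
   represented by the next two polynomials.  They arise from p_poly at the triples
   (3, 10, 3) and (4, 9, 2), which meet every clause of admissible except n/m > 1,
   by the substitution x := x + 3 y resp. x := x + 2 y, which carries S(3) to S(3/10)
   resp. S(4) to S(4/9).  They are equivalent neither to an f_poly or g_poly nor to a
   p_poly at an admissible triple, so a complete list of representatives needs them. *)
definition exc3_poly :: poly2 where
  "exc3_poly = const2 (3 / 2) * varX\<^sup>2 - const2 (7 / 2) * varX + const2 3 * varY + const2 2"

definition exc4_poly :: poly2 where
  "exc4_poly = const2 2 * varX\<^sup>2 - const2 3 * varX + const2 2 * varY + const2 1"

end

theory Submission
  imports Defs
begin

text \<open>
  Let \<open>p\<close> be a quadratic packing polynomial on \<open>S(n/m)\<close> with quadratic form \<open>Q\<close>. If \<open>Q\<close> vanished in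
  a lattice direction of the sector, then the rays in that direction would yield infinitely many
  disjoint arithmetic progressions of natural numbers whose differences grow only linearly. So \<open>Q\<close>
  is positive and grows quadratically, whence translating the argument changes \<open>p\<close> only by a
  factor close to \<open>1\<close>, and all residue classes of lattice points are equally dense with respect to
  the size of \<open>p\<close>. A prime not dividing the discriminant of \<open>Q\<close> contradicts this, so \<open>Q\<close> is a
  multiple of the square of a linear form \<open>j\<close>.

  In unimodular coordinates \<open>(j, i)\<close> one has \<open>p = a j\<^sup>2 / 2 + b j + d i + f\<close> with \<open>d > 0\<close>, on a wedge
  between two slopes that differ by \<open>a\<close>, because of the density of the values. On each level \<open>j\<close> the
  values form an arithmetic progression with difference \<open>d\<close>, and for large \<open>j\<close> it must be
  continued by level \<open>j + d\<close>. As the boundary of the wedge is periodic, this holds on all levels;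
  it determines the slopes and \<open>b\<close>. Finally, the first values of the levels \<open>0, \<dots>, d - 1\<close> must be
  a permutation of \<open>0, \<dots>, d - 1\<close>. Summing them up gives \<open>12 f = a (d\<^sup>2 - 1)\<close>, hence
  \<open>a (d + 1) \<le> 12\<close> for \<open>d \<ge> 2\<close>, and only \<open>d = 1\<close>, \<open>(d, a) = (2, 4)\<close> and \<open>(d, a) = (3, 3)\<close> survive;
  this \<open>d\<close> is the parameter \<open>k\<close> of the theorem.
\<close>

section \<open>Levels of a wedge and chains of progressions\<close>

text \<open>The lattice points of the sector \<open>S(n/m)\<close> form \<open>wedge 0 1 n m\<close>.\<close>

definition wedge :: "int \<Rightarrow> int \<Rightarrow> int \<Rightarrow> int \<Rightarrow> (int \<times> int) set" where
  "wedge c q c' q' = {(j, i). c * j \<le> q * i \<and> q' * i \<le> c' * j}"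

text \<open>Every value of at least \<open>d\<close> descends along \<open>s\<close> to one smaller
  by \<open>d\<close>, while values below \<open>d\<close> occur only on \<open>S\<close>. Induction
  on the value therefore reduces injectivity and surjectivity on \<open>W\<close> to those on
  \<open>S\<close>.\<close>

lemma bij_betw_successor:
  fixes P :: "'a \<Rightarrow> int"
  assumes "d > 0" and nonneg: "\<And>z. z \<in> W \<Longrightarrow> P z \<ge> 0"
    and succ: "\<And>z. z \<in> W \<Longrightarrow> s z \<in> W" "\<And>z. z \<in> W \<Longrightarrow> P (s z) = P z + d"
    and cover: "\<And>z. z \<in> W \<Longrightarrow> z \<in> S \<or> z \<in> s ` W"
    and S: "S \<subseteq> W" "bij_betw P S {0..<d}"
  shows "bij_betw P W {0..}"
proof -
  have "\<forall>z\<in>W. \<forall>z'\<in>W. P z = v \<longrightarrow> P z' = v \<longrightarrow> z = z'" if "v \<ge> 0" for v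
    using that
  proof (induction "nat v" arbitrary: v rule: less_induct)
    case less
    show ?case
    proof (intro ballI impI)
      fix z z' assume z: "z \<in> W" "z' \<in> W" "P z = v" "P z' = v"
      show "z = z'"
      proof (cases "v < d")
        case True
        have "y \<in> S" if "y \<in> W" "P y = v" for y
          using cover[OF that(1)] that True succ(2) nonneg by fastforce
        then show ?thesis
          using z S(2) by (metis bij_betw_inv_into_left)
      next
        case False
        have "y \<in> s ` W" if "y \<in> W" "P y = v" for y
          using cover[OF that(1)] that False bij_betwE[OF S(2)] by fastforce
        then have "z \<in> s ` W" "z' \<in> s ` W" using z by blast+
        then obtain y y' where y: "y \<in> W" "y' \<in> W" "z = s y" "z' = s y'"
          by blast
        then have "P y = v - d" "P y' = v - d"
          using z succ(2) by force+
        moreover have "nat (v - d) < nat v" "v - d \<ge> 0"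
          using False \<open>d > 0\<close> by auto
        ultimately have "y = y'"
          using less.hyps[of "v - d"] y by blast
        with y show ?thesis by simp
      qed
    qed
  qed
  then have "inj_on P W"
    using nonneg by (auto intro!: inj_onI)
  moreover have "v \<in> P ` W" if "v \<ge> 0" for v
    using that
  proof (induction "nat v" arbitrary: v rule: less_induct)
    case less
    show ?case
    proof (cases "v < d")
      case True
      then have "v \<in> P ` S"
        using less.prems by (simp add: bij_betw_imp_surj_on[OF S(2)])
      then show ?thesis using S(1) by blast
    next
      case False
      then have "v - d \<in> P ` W"
        using less.prems \<open>d > 0\<close> by (intro less.hyps) auto
      then obtain z where "z \<in> W" "P z = v - d"
        by force
      then have "s z \<in> W" "v = P (s z)" using succ by auto
      then show ?thesis by blast
    qed
  qed
  ultimately show ?thesis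
    using nonneg by (auto simp: bij_betw_def)
qed

lemma le_div_add_iff:
  fixes x q i k :: int
  assumes "q > 0"
  shows "i \<le> x div q + k \<longleftrightarrow> q * i \<le> x + k * q"
proof -
  have "i - k \<le> x div q \<longleftrightarrow> q * (i - k) \<le> x"
  proof
    assume "i - k \<le> x div q"
    then have "q * (i - k) \<le> q * (x div q)" using assms by simp
    also have "\<dots> \<le> x" using assms by (simp add: minus_mod_eq_mult_div [symmetric])
    finally show "q * (i - k) \<le> x" .
  next
    assume "q * (i - k) \<le> x"
    then have "q * (i - k) div q \<le> x div q" using assms by (intro zdiv_mono1)
    then show "i - k \<le> x div q" using assms by simp
  qed
  then show ?thesis by (auto simp: algebra_simps)
qed

text \<open>\<open>(x - 1) div q + 1\<close> is the ceiling of \<open>x / q\<close>; the lower ends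
  of the levels are written this way.\<close>

lemma div_add_one_le_iff:
  fixes x q i :: int
  assumes "q > 0"
  shows "(x - 1) div q + 1 \<le> i \<longleftrightarrow> x \<le> q * i"
  using le_div_add_iff[OF assms, of i "x - 1" 0] by linarith

text \<open>Level \<open>j\<close> of the wedge carries an arithmetic progression of common difference \<open>d\<close>;
  \<open>lo j\<close> and \<open>hi j\<close> are the second coordinates of its ends.\<close>

locale levels =
  fixes a b d q c f :: int and P :: "int \<Rightarrow> int \<Rightarrow> int"
  assumes pos: "a > 0" "d > 0" "q > 0"
    and P: "\<And>j i. 2 * P j i = a * j\<^sup>2 + b * j + 2 * d * i + 2 * f"
begin

definition "lo j = (c * j - 1) div q + 1"
definition "hi j = c * j div q + a * j"

lemma lo_le_iff: "lo j \<le> i \<longleftrightarrow> c * j \<le> q * i"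
  unfolding lo_def using pos by (simp add: div_add_one_le_iff)

lemma le_hi_iff: "i \<le> hi j \<longleftrightarrow> q * i \<le> (c + a * q) * j"
  unfolding hi_def using le_div_add_iff[OF pos(3), of i "c * j" "a * j"] by (simp add: algebra_simps)

lemma mem_wedge_iff: "(j, i) \<in> wedge c q (c + a * q) q \<longleftrightarrow> lo j \<le> i \<and> i \<le> hi j"
  by (simp add: wedge_def lo_le_iff le_hi_iff)

lemma mem_wedge_nonneg:
  assumes "(j, i) \<in> wedge c q (c + a * q) q" shows "j \<ge> 0"
proof -
  have "c * j \<le> (c + a * q) * j"
    using assms by (simp add: wedge_def)
  then have "0 \<le> (a * q) * j" by (simp add: algebra_simps)
  moreover have "a * q > 0" using pos by simp
  ultimately show ?thesis by (simp only: zero_le_mult_iff) auto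
qed

lemma lo_le_hi:
  assumes "j \<ge> 0" shows "lo j \<le> hi j"
proof (cases "j = 0")
  case True
  then show ?thesis by (simp add: lo_le_iff hi_def)
next
  case False
  have "(c * j - 1) div q \<le> c * j div q"
    using pos by (simp add: zdiv_mono1)
  moreover have "a * j \<ge> 1"
    using False assms pos by (simp add: int_one_le_iff_zero_less)
  ultimately show ?thesis by (simp add: lo_def hi_def)
qed

lemma P_add: "P j (i + k) = P j i + d * k"
proof -
  have "2 * P j (i + k) = 2 * (P j i + d * k)"
    unfolding distrib_left P by (simp add: algebra_simps)
  then show ?thesis by simp
qed

end

text \<open>The relation \<open>cd\<close> and the special linear coefficient make the progression
  on level \<open>j + d\<close> begin exactly one step of length \<open>d\<close> after the one on
  level \<open>j\<close> ends.\<close>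

locale chain = levels a "- (a * d + 2 * h)" d q c f P for a d q c h f P +
  assumes cd: "c * d = 1 + q * h"
begin

lemma lo_add_d: "lo (j + d) = c * j div q + h + 1"
proof -
  have "c * (j + d) - 1 = c * j + h * q"
    using cd by (simp add: algebra_simps)
  then show ?thesis unfolding lo_def using pos by simp
qed

lemma P_lo_add_d: "P (j + d) (lo (j + d)) = P j (hi j) + d"
proof -
  have "2 * P (j + d) (lo (j + d)) = 2 * (P j (hi j) + d)"
    unfolding distrib_left P unfolding lo_add_d hi_def
    by (simp add: algebra_simps power2_eq_square)
  then show ?thesis by simp
qed

text \<open>The identity \<open>q * (d * lo j - h * j) = j + d * (q - 1 - r)\<close>, with
  \<open>r\<close> the remainder of \<open>c * j - 1\<close> modulo \<open>q\<close>, places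
  \<open>d * lo j - h * j\<close> in \<open>{0..<d}\<close>. Being congruent to
  \<open>- h * j\<close> modulo \<open>d\<close>, it is that residue.\<close>

lemma lo_residue:
  assumes "0 \<le> j" "j < d"
  shows "d * lo j - h * j = (- h * j) mod d"
proof -
  define r where "r = (c * j - 1) mod q"
  have r: "0 \<le> r" "r \<le> q - 1" using pos by (simp_all add: r_def)
  have "q * lo j = c * j - 1 - r + q"
    unfolding lo_def r_def by (simp add: algebra_simps minus_mod_eq_mult_div [symmetric])
  then have "q * (d * lo j - h * j) = d * (c * j - 1 - r + q) - q * h * j"
    by (simp add: right_diff_distrib)
  also have "\<dots> = (c * d - q * h) * j + d * (q - 1 - r)"
    by (simp add: algebra_simps)
  finally have eq: "q * (d * lo j - h * j) = j + d * (q - 1 - r)"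
    using cd by simp
  have "d * (q - 1 - r) \<ge> 0" using pos r by simp
  with eq assms have "q * (d * lo j - h * j) \<ge> 0" by simp
  then have ge: "d * lo j - h * j \<ge> 0" using pos by (simp add: zero_le_mult_iff)
  have "d * (q - 1 - r) \<le> d * (q - 1)" using pos r by simp
  with eq assms have "q * (d * lo j - h * j) < q * d" by (simp add: algebra_simps)
  then have "d * lo j - h * j < d" using pos by simp
  with ge have "d * lo j - h * j = (d * lo j - h * j) mod d" by simp
  also have "\<dots> = (- h * j) mod d"
    by (simp add: mod_eq_dvd_iff)
  finally show ?thesis .
qed

lemma P_lo:
  assumes "0 \<le> j" "j < d"
  shows "2 * P j (lo j) = 2 * f - a * (j * (d - j)) + 2 * ((- h * j) mod d)"
  unfolding P lo_residue[OF assms, symmetric] by (simp add: algebra_simps power2_eq_square)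

text \<open>The successor map moves one point up within a level and from the top of level
  \<open>j\<close> to the bottom of level \<open>j + d\<close>, raising the value by
  \<open>d\<close> each time. The only points it does not reach are the bottoms of the levels below
  \<open>d\<close>.\<close>

lemma P_bij:
  assumes start: "bij_betw (\<lambda>j. P j (lo j)) {0..<d} {0..<d}"
  shows "bij_betw (\<lambda>(j, i). P j i) (wedge c q (c + a * q) q) {0..}"
proof -
  have P_ge: "P j (lo j) \<le> P j i" if "lo j \<le> i" for j i
    using P_add[of j "lo j" "i - lo j"] that pos by simp
  have lo_nonneg: "P j (lo j) \<ge> 0" if "j \<ge> 0" for j
    using that
  proof (induction "nat j" arbitrary: j rule: less_induct)
    case less
    show ?case
    proof (cases "j < d")
      case True
      then show ?thesis using bij_betwE[OF start] less.prems by force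
    next
      case False
      then have "0 \<le> P (j - d) (lo (j - d))" using less pos by force
      also have "\<dots> \<le> P (j - d) (hi (j - d))" using P_ge lo_le_hi False by force
      finally show ?thesis using P_lo_add_d[of "j - d"] pos by simp
    qed
  qed
  define s where "s = (\<lambda>(j, i). if i < hi j then (j, i + 1) else (j + d, lo (j + d)))"
  define S where "S = (\<lambda>j. (j, lo j)) ` {0..<d}"
  let ?W = "wedge c q (c + a * q) q"
  show ?thesis
  proof (rule bij_betw_successor[where s = s and S = S and d = d])
    show "0 \<le> (case z of (j, i) \<Rightarrow> P j i)" if "z \<in> ?W" for z
    proof (cases z)
      case (Pair j i)
      with that have "0 \<le> P j (lo j)" "P j (lo j) \<le> P j i"
        using lo_nonneg P_ge mem_wedge_nonneg mem_wedge_iff by blast+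
      with Pair show ?thesis by simp
    qed
    show "s z \<in> ?W" if "z \<in> ?W" for z
      using that mem_wedge_nonneg pos by (cases z) (auto simp: s_def mem_wedge_iff lo_le_hi)
    show "(case s z of (j, i) \<Rightarrow> P j i) = (case z of (j, i) \<Rightarrow> P j i) + d" if "z \<in> ?W" for z
      using that P_lo_add_d P_add[of _ _ 1] by (cases z) (auto simp: s_def mem_wedge_iff)
    show "z \<in> S \<or> z \<in> s ` ?W" if z: "z \<in> ?W" for z
    proof (cases z)
      case (Pair j i)
      have j: "j \<ge> 0" "lo j \<le> i" "i \<le> hi j" using z mem_wedge_nonneg Pair mem_wedge_iff by auto
      consider "lo j < i" | "i = lo j" "j < d" | "i = lo j" "j \<ge> d" using j by linarith
      then show ?thesis
      proof cases
        case 1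
        then have "(j, i - 1) \<in> ?W" "s (j, i - 1) = z" using j by (auto simp: mem_wedge_iff s_def Pair)
        then show ?thesis by force
      next
        case 2
        then show ?thesis using j by (auto simp: S_def Pair)
      next
        case 3
        then have "(j - d, hi (j - d)) \<in> ?W" "s (j - d, hi (j - d)) = z"
          using j lo_le_hi by (auto simp: mem_wedge_iff s_def Pair)
        then show ?thesis by force
      qed
    qed
    show "S \<subseteq> ?W" by (auto simp: S_def mem_wedge_iff lo_le_hi)
    show "bij_betw (\<lambda>(j, i). P j i) S {0..<d}"
      using start unfolding S_def bij_betw_def by (auto simp: inj_on_def image_image)
  qed (use pos in auto)
qed

end

text \<open>The constant \<open>f\<close> is the one forced by
  \<open>12 * f = a * (d\<^sup>2 - 1)\<close>, and \<open>a\<close> stays free only for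
  \<open>d = 1\<close>.\<close>

definition good_start :: "int \<Rightarrow> int \<Rightarrow> int \<Rightarrow> bool" where
  "good_start a d f \<longleftrightarrow> d = 1 \<and> f = 0 \<or> d = 2 \<and> a = 4 \<and> f = 1 \<or> d = 3 \<and> a = 3 \<and> f = 2"

context chain
begin

text \<open>By \<open>P_lo\<close> the start values depend on \<open>h\<close> only modulo
  \<open>d\<close>, and \<open>cd\<close> makes \<open>h\<close> a unit modulo \<open>d\<close>. For
  \<open>d = 2\<close> the starts are 1, 0; for \<open>d = 3\<close> they are 2 and then, in either
  order, 0 and 1.\<close>

lemma P_bij_good:
  assumes "good_start a d f"
  shows "bij_betw (\<lambda>(j, i). P j i) (wedge c q (c + a * q) q) {0..}"
proof (rule P_bij)
  consider "d = 1" "f = 0" | "d = 2" "a = 4" "f = 1" | "d = 3" "a = 3" "f = 2"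
    using assms by (auto simp: good_start_def)
  then show "bij_betw (\<lambda>j. P j (lo j)) {0..<d} {0..<d}"
  proof cases
    case 1
    moreover have "{0..<1::int} = {0}" by auto
    ultimately show ?thesis using P_lo[of 0] by (simp add: bij_betw_def)
  next
    case 2
    have "h mod 2 \<noteq> 0"
    proof
      assume "h mod 2 = 0"
      then have "even (c * d - q * h)" using 2 by auto
      with cd show False by simp
    qed
    then have "(- h) mod 2 = 1" by presburger
    then have "P 0 (lo 0) = 1" "P 1 (lo 1) = 0"
      using P_lo[of 0] P_lo[of 1] 2 by auto
    moreover have "{0..<2::int} = {0, 1}" by auto
    ultimately show ?thesis using 2 by (auto simp: bij_betw_def)
  next
    case 3
    have "h mod 3 \<noteq> 0"
    proof
      assume "h mod 3 = 0"
      then have "3 dvd (c * d - q * h)" using 3 by auto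
      with cd show False by simp
    qed
    then have "(- h) mod 3 = 1 \<and> (- h * 2) mod 3 = 2 \<or> (- h) mod 3 = 2 \<and> (- h * 2) mod 3 = 1"
      by presburger
    then have "P 0 (lo 0) = 2" "P 1 (lo 1) = 0 \<and> P 2 (lo 2) = 1 \<or> P 1 (lo 1) = 1 \<and> P 2 (lo 2) = 0"
      using P_lo[of 0] P_lo[of 1] P_lo[of 2] 3 by auto
    moreover have "{0..<3::int} = {0, 1, 2}" by auto
    ultimately show ?thesis using 3 by (auto simp: bij_betw_def)
  qed
qed

end

section \<open>Slopes of the wedge\<close>

text \<open>An inequality valid for all large \<open>N\<close> passes to the leading coefficients;
  asymptotic counts are compared in this way without limits.\<close>

lemma int_quadratic_le_linear:
  fixes x u v :: int
  assumes "\<And>N :: nat. N \<ge> K \<Longrightarrow> x * (int N)\<^sup>2 \<le> u * int N + v"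
  shows "x \<le> 0"
proof (rule ccontr)
  assume "\<not> x \<le> 0"
  define N where "N = K + nat (\<bar>u\<bar> + \<bar>v\<bar> + 1)"
  have N: "int N \<ge> \<bar>u\<bar> + \<bar>v\<bar> + 1" by (simp add: N_def)
  have "\<bar>u\<bar> * int N + \<bar>v\<bar> * 1 < (\<bar>u\<bar> + \<bar>v\<bar> + 1) * int N"
  proof -
    have "int N \<ge> 1" using N by simp
    then have "\<bar>v\<bar> * 1 \<le> \<bar>v\<bar> * int N" by (intro mult_left_mono) auto
    with \<open>int N \<ge> 1\<close> show ?thesis by (simp add: algebra_simps)
  qed
  also have "\<dots> \<le> (int N)\<^sup>2"
    using N by (simp add: power2_eq_square mult_right_mono)
  also have "\<dots> \<le> x * (int N)\<^sup>2"
    using \<open>\<not> x \<le> 0\<close> mult_right_mono[of 1 x "(int N)\<^sup>2"] by simp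
  also have "\<dots> \<le> u * int N + v"
    using assms[of N] by (simp add: N_def)
  also have "\<dots> \<le> \<bar>u\<bar> * int N + \<bar>v\<bar> * 1"
    by (simp add: add_mono mult_right_mono)
  finally show False by simp
qed

text \<open>Both inequalities between the difference of the slopes and \<open>a\<close> come from comparing the number
  of lattice points up to a given level with the values attained there.\<close>

lemma wedge_slopes:
  fixes a b d f :: int
  assumes pos: "a > 0" "d > 0" "q > 0" "q' > 0" and slopes: "c * q' < c' * q"
    and P: "\<And>j i. 2 * P j i = a * j\<^sup>2 + b * j + 2 * d * i + 2 * f"
    and bij: "bij_betw (\<lambda>(j, i). P j i) (wedge c q c' q') {0..}"
  shows "c' * q - c * q' = a * (q * q')"
proof -
  define \<Delta> where "\<Delta> = c' * q - c * q'"
  define Q where "Q = q * q'"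
  have Q: "Q > 0" "\<Delta> > 0" using pos slopes by (simp_all add: Q_def \<Delta>_def)
  define lo where "lo j = (c * j - 1) div q + 1" for j
  define hi where "hi j = c' * j div q'" for j
  have mem: "(j, i) \<in> wedge c q c' q' \<longleftrightarrow> lo j \<le> i \<and> i \<le> hi j" for j i
    using pos le_div_add_iff[of q' i "c' * j" 0] by (simp add: wedge_def lo_def hi_def div_add_one_le_iff)
  have level_nonneg: "j \<ge> 0" if "(j, i) \<in> wedge c q c' q'" for j i
  proof -
    have "q' * (c * j) \<le> q' * (q * i)" "q * (q' * i) \<le> q * (c' * j)"
      using that pos by (auto simp: wedge_def)
    then have "0 \<le> \<Delta> * j" by (simp add: \<Delta>_def algebra_simps)
    then show ?thesis using Q by (simp only: zero_le_mult_iff) auto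
  qed
  have lo: "c * j \<le> q * lo j" "q * lo j < c * j + q" for j
    using div_add_one_le_iff[of q "c * j" "lo j"] div_add_one_le_iff[of q "c * j" "lo j - 1"] pos
    by (simp_all add: lo_def algebra_simps)
  have hi: "q' * hi j \<le> c' * j" "c' * j < q' * hi j + q'" for j
    using le_div_add_iff[of q' "hi j" "c' * j" 0] le_div_add_iff[of q' "hi j + 1" "c' * j" 0] pos
    by (auto simp: hi_def distrib_left)
  \<comment> \<open>Before rounding, level \<open>j\<close> of the wedge has length
    \<open>\<Delta> * j / Q\<close>; rounding both ends inward shortens it by less than 2.\<close>
  have width: "Q * (hi j - lo j) \<le> \<Delta> * j" "\<Delta> * j < Q * (hi j - lo j) + 2 * Q" for j
  proof -
    have "q' * (c * j) \<le> q' * (q * lo j)" "q' * (q * lo j) < q' * (c * j + q)"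
      "q * (q' * hi j) \<le> q * (c' * j)" "q * (c' * j) < q * (q' * hi j + q')"
      using lo hi pos by simp_all
    then show "Q * (hi j - lo j) \<le> \<Delta> * j" "\<Delta> * j < Q * (hi j - lo j) + 2 * Q"
      by (simp_all add: Q_def \<Delta>_def algebra_simps)
  qed
  define L where "L N = (SIGMA k:{..N}. {lo (int k)..hi (int k)})" for N :: nat
  define cnt where "cnt k = int (card {lo (int k)..hi (int k)})" for k :: nat
  have L_card: "int (card (L N)) = (\<Sum>k\<le>N. cnt k)" for N
    by (simp add: L_def cnt_def)
  have "\<Delta> * int k - Q \<le> Q * cnt k \<and> Q * cnt k \<le> \<Delta> * int k + Q" for k
  proof -
    have "cnt k = max 0 (hi (int k) - lo (int k) + 1)" by (simp add: cnt_def)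
    then consider "cnt k = 0" "hi (int k) - lo (int k) + 1 \<le> 0" | "cnt k = hi (int k) - lo (int k) + 1"
      by linarith
    then show ?thesis
    proof cases
      case 1
      then have "Q * (hi (int k) - lo (int k) + 1) \<le> 0" using Q by (simp add: mult_le_0_iff)
      moreover have "\<Delta> * int k \<ge> 0" using Q by simp
      ultimately show ?thesis using 1 width(2)[of "int k"] Q by (simp add: algebra_simps)
    next
      case 2
      then have "Q * cnt k = Q * (hi (int k) - lo (int k)) + Q" by (simp add: distrib_left)
      then show ?thesis using width[of "int k"] by simp
    qed
  qed
  then have cnt: "\<Delta> * int k - Q \<le> Q * cnt k" "Q * cnt k \<le> \<Delta> * int k + Q" for k
    by blast+
  have gauss: "2 * (\<Sum>k\<le>N. int k) = int N * (int N + 1)" for N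
    using double_gauss_sum[of N, where 'a = int] by (simp add: atLeast0AtMost)
  have card_ge: "\<Delta> * (int N * (int N + 1)) - 2 * Q * (int N + 1) \<le> 2 * Q * int (card (L N))" for N
  proof -
    have "(\<Sum>k\<le>N. \<Delta> * int k - Q) \<le> (\<Sum>k\<le>N. Q * cnt k)" using cnt by (intro sum_mono) auto
    then have "\<Delta> * (\<Sum>k\<le>N. int k) - (int N + 1) * Q \<le> Q * int (card (L N))"
      by (simp add: sum_subtractf sum_distrib_left L_card add.commute)
    then show ?thesis unfolding gauss[symmetric] by (simp add: algebra_simps)
  qed
  have card_le: "2 * Q * int (card (L N)) \<le> \<Delta> * (int N * (int N + 1)) + 2 * Q * (int N + 1)" for N
  proof -
    have "(\<Sum>k\<le>N. Q * cnt k) \<le> (\<Sum>k\<le>N. \<Delta> * int k + Q)" using cnt by (intro sum_mono) auto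
    then have "Q * int (card (L N)) \<le> \<Delta> * (\<Sum>k\<le>N. int k) + (int N + 1) * Q"
      by (simp add: sum.distrib sum_distrib_left L_card add.commute)
    then show ?thesis unfolding gauss[symmetric] by (simp add: algebra_simps)
  qed
  \<comment> \<open>On the wedge \<open>i\<close> is at most \<open>(|c| + |c'|) * j\<close> in
    absolute value, so \<open>\<kappa> * j\<close> bounds the terms of \<open>2 * P j i\<close> that
    are linear in \<open>j\<close> and \<open>i\<close>.\<close>
  define \<kappa> where "\<kappa> = \<bar>b\<bar> + 2 * d * (\<bar>c\<bar> + \<bar>c'\<bar>)"
  have \<kappa>: "\<kappa> \<ge> 0" using pos by (simp add: \<kappa>_def)
  have bounds: "2 * P j i \<le> a * j\<^sup>2 + \<kappa> * j + 2 * f" "a * j\<^sup>2 - \<kappa> * j + 2 * f \<le> 2 * P j i"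
    if W: "(j, i) \<in> wedge c q c' q'" for j i
  proof -
    have j: "j \<ge> 0" using level_nonneg W by blast
    have abs_j: "\<bar>c * j\<bar> = \<bar>c\<bar> * j" "\<bar>c' * j\<bar> = \<bar>c'\<bar> * j" using j by (simp_all add: abs_mult)
    have "i \<le> \<bar>c'\<bar> * j"
    proof (cases "i \<ge> 0")
      case True
      then have "i \<le> q' * i" using pos mult_right_mono[of 1 q' i] by simp
      also have "\<dots> \<le> c' * j" using W by (simp add: wedge_def)
      finally show ?thesis using abs_j(2) by linarith
    qed (use abs_j(2) in linarith)
    moreover have "- i \<le> \<bar>c\<bar> * j"
    proof (cases "i \<le> 0")
      case True
      then have "- i \<le> - (q * i)" using pos mult_right_mono_neg[of 1 q i] by simp
      also have "\<dots> \<le> - (c * j)" using W by (simp add: wedge_def)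
      finally show ?thesis using abs_j(1) by linarith
    qed (use abs_j(1) in linarith)
    moreover have "\<bar>c\<bar> * j \<ge> 0" "\<bar>c'\<bar> * j \<ge> 0" using j by auto
    ultimately have "\<bar>i\<bar> \<le> (\<bar>c\<bar> + \<bar>c'\<bar>) * j"
      unfolding distrib_right by linarith
    then have "\<bar>2 * d * i\<bar> \<le> 2 * d * ((\<bar>c\<bar> + \<bar>c'\<bar>) * j)"
      using pos by (simp add: abs_mult)
    moreover have "\<bar>b * j\<bar> \<le> \<bar>b\<bar> * j" using j by (simp add: abs_mult)
    ultimately have "\<bar>b * j + 2 * d * i\<bar> \<le> \<kappa> * j"
      unfolding \<kappa>_def distrib_right mult.assoc by linarith
    then show "2 * P j i \<le> a * j\<^sup>2 + \<kappa> * j + 2 * f" "a * j\<^sup>2 - \<kappa> * j + 2 * f \<le> 2 * P j i"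
      unfolding P by linarith+
  qed
  define v where "v = (\<lambda>(k, i). P (int k) i)"
  have L_mem: "(int k, i) \<in> wedge c q c' q'" "k \<le> N" if "(k, i) \<in> L N" for k i N
    using that by (auto simp: L_def mem)
  have fin_L: "finite (L N)" for N by (simp add: L_def)
  \<comment> \<open>Injectivity: the points on levels up to \<open>N\<close> are roughly
    \<open>\<Delta> * N\<^sup>2 / (2 * Q)\<close> in number and have distinct values between 0 and
    roughly \<open>a * N\<^sup>2 / 2\<close>.\<close>
  have "\<Delta> - a * Q \<le> 0"
  proof (rule int_quadratic_le_linear[where K = 0])
    fix N
    have v_inj: "inj_on v (L N)"
    proof (rule inj_onI)
      fix z z' assume z: "z \<in> L N" "z' \<in> L N" "v z = v z'"
      obtain k i k' i' where zz: "z = (k, i)" "z' = (k', i')" by force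
      then have "(int k, i) \<in> wedge c q c' q'" "(int k', i') \<in> wedge c q c' q'"
        using z L_mem by blast+
      then have "(int k, i) = (int k', i')"
        using z(3) by (intro inj_onD[OF bij_betw_imp_inj_on[OF bij]]) (auto simp: v_def zz)
      then show "z = z'" by (simp add: zz)
    qed
    define V where "V = (a * (int N)\<^sup>2 + \<kappa> * int N + 2 * f)"
    have "v z \<in> {0..V div 2}" if "z \<in> L N" for z
    proof (cases z)
      case (Pair k i)
      then have W: "(int k, i) \<in> wedge c q c' q'" "int k \<le> int N" using that L_mem by auto
      then have "P (int k) i \<ge> 0" using bij_betwE[OF bij] by fastforce
      moreover have "a * (int k)\<^sup>2 \<le> a * (int N)\<^sup>2" "\<kappa> * int k \<le> \<kappa> * int N"
        using W(2) pos \<kappa> by (auto intro: mult_left_mono power_mono)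
      then have "2 * P (int k) i \<le> V"
        using bounds(1)[OF W(1)] by (simp add: V_def)
      ultimately show ?thesis by (simp add: v_def Pair)
    qed
    then have "card (L N) \<le> card {0..V div 2}"
      using v_inj by (intro card_inj_on_le) auto
    \<comment> \<open>The value at the origin shows that the interval is not empty, so its
      cardinality is \<open>V div 2 + 1\<close> as an integer.\<close>
    moreover have "v (0, 0) \<in> {0..V div 2}"
      by (rule \<open>\<And>z. z \<in> L N \<Longrightarrow> v z \<in> {0..V div 2}\<close>) (auto simp: L_def mem[symmetric] wedge_def)
    ultimately have "int (card (L N)) \<le> V div 2 + 1" by auto
    then have "2 * int (card (L N)) \<le> V + 2" by linarith
    then have "Q * (2 * int (card (L N))) \<le> Q * (V + 2)" using Q by simp
    with card_ge[of N] have "\<Delta> * (int N * (int N + 1)) - 2 * Q * (int N + 1) \<le> Q * (V + 2)" by (simp add: mult_ac)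
    then show "(\<Delta> - a * Q) * (int N)\<^sup>2 \<le> (Q * \<kappa> + 2 * Q - \<Delta>) * int N + (4 * Q + 2 * Q * f)"
      by (simp add: V_def algebra_simps power2_eq_square)
  qed
  \<comment> \<open>Surjectivity: the values below \<open>V div 2\<close> are all taken on levels up
    to \<open>N\<close>. For \<open>N\<close> beyond \<open>\<kappa>\<close>, the lower bound
    \<open>(a * j - \<kappa>) * j\<close> increases from level \<open>N\<close> on, so higher levels
    carry no such value.\<close>
  moreover have "a * Q - \<Delta> \<le> 0"
  proof (rule int_quadratic_le_linear[where K = "nat (\<kappa> + 1)"])
    fix N assume N: "N \<ge> nat (\<kappa> + 1)"
    define V where "V = (a * (int N)\<^sup>2 - \<kappa> * int N + 2 * f)"
    have "{0..<V div 2} \<subseteq> v ` L N"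
    proof
      fix w assume w: "w \<in> {0..<V div 2}"
      then have "w \<in> (\<lambda>(j, i). P j i) ` wedge c q c' q'"
        using bij_betw_imp_surj_on[OF bij] by simp
      then obtain j i where W: "(j, i) \<in> wedge c q c' q'" "w = P j i" by auto
      have "j \<le> int N"
      proof (rule ccontr)
        assume "\<not> j \<le> int N"
        then have "a * j - \<kappa> \<ge> a * int N - \<kappa>" "a * int N - \<kappa> \<ge> 0" "j \<ge> int N"
          using pos N mult_right_mono[of 1 a "int N"] by (auto intro!: mult_left_mono)
        then have "(a * int N - \<kappa>) * int N \<le> (a * j - \<kappa>) * j"
          by (intro mult_mono) auto
        then have "V \<le> 2 * w"
          using bounds(2)[OF W(1)] W(2) by (simp add: V_def algebra_simps power2_eq_square)
        with w show False by auto
      qed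
      with W level_nonneg[OF W(1)] have "(nat j, i) \<in> L N" "w = v (nat j, i)"
        by (auto simp: L_def mem v_def)
      then show "w \<in> v ` L N" by blast
    qed
    then have "card {0..<V div 2} \<le> card (L N)"
      by (rule surj_card_le[OF fin_L])
    then have "V div 2 \<le> int (card (L N))" by auto
    then have "V - 1 \<le> 2 * int (card (L N))" by linarith
    then have "Q * (V - 1) \<le> Q * (2 * int (card (L N)))" using Q by simp
    with card_le[of N] have "Q * (V - 1) \<le> \<Delta> * (int N * (int N + 1)) + 2 * Q * (int N + 1)" by (simp add: mult_ac)
    then show "(a * Q - \<Delta>) * (int N)\<^sup>2 \<le> (Q * \<kappa> + 2 * Q + \<Delta>) * int N + (3 * Q - 2 * Q * f)"
      by (simp add: V_def algebra_simps power2_eq_square)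
  qed
  ultimately show ?thesis by (simp add: \<Delta>_def Q_def)
qed

section \<open>The finitely many chain parameters\<close>

context levels
begin

text \<open>Multiplication by \<open>q\<close> trades the quotients for remainders, so the end
  values become polynomials in \<open>j\<close> up to a bounded error.\<close>

lemma level_end_values:
  "q * (2 * P j (lo j)) = q * (a * j\<^sup>2 + b * j + 2 * f) + 2 * d * (c * j + (q - 1 - (c * j - 1) mod q))"
  "q * (2 * P j (hi j)) = q * (a * j\<^sup>2 + b * j + 2 * f) + 2 * d * (c * j + a * q * j - c * j mod q)"
proof -
  have "q * ((c * j - 1) div q) = c * j - 1 - (c * j - 1) mod q" "q * (c * j div q) = c * j - c * j mod q"
    by (simp_all add: minus_mod_eq_mult_div)
  then have "q * lo j = c * j + (q - 1 - (c * j - 1) mod q)" "q * hi j = c * j + a * q * j - c * j mod q"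
    unfolding lo_def hi_def distrib_left by (simp_all add: mult_ac)
  moreover have "q * (2 * P j i) = q * (a * j\<^sup>2 + b * j + 2 * f) + 2 * d * (q * i)" for i
    unfolding P by (simp add: algebra_simps)
  ultimately show "q * (2 * P j (lo j)) = q * (a * j\<^sup>2 + b * j + 2 * f) + 2 * d * (c * j + (q - 1 - (c * j - 1) mod q))"
  "q * (2 * P j (hi j)) = q * (a * j\<^sup>2 + b * j + 2 * f) + 2 * d * (c * j + a * q * j - c * j mod q)"
    by simp_all
qed

end

locale bij_levels = levels +
  assumes bij: "bij_betw (\<lambda>(j, i). P j i) (wedge c q (c + a * q) q) {0..}"
begin

lemma P_nonneg: "(j, i) \<in> wedge c q (c + a * q) q \<Longrightarrow> P j i \<ge> 0"
  using bij_betwE[OF bij] by fastforce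

lemma P_inj:
  assumes "(j, i) \<in> wedge c q (c + a * q) q" "(j', i') \<in> wedge c q (c + a * q) q" "P j i = P j' i'"
  shows "j = j'" "i = i'"
proof -
  have "(j, i) = (j', i')"
    using assms by (intro inj_onD[OF bij_betw_imp_inj_on[OF bij]]) auto
  then show "j = j'" "i = i'" by auto
qed

lemma P_surj:
  assumes "w \<ge> 0" obtains j i where "(j, i) \<in> wedge c q (c + a * q) q" "P j i = w"
proof -
  have "w \<in> (\<lambda>(j, i). P j i) ` wedge c q (c + a * q) q"
    using assms bij_betw_imp_surj_on[OF bij] by simp
  then show ?thesis using that by auto
qed

text \<open>The top value of level \<open>j\<close> plus \<open>d\<close> is taken somewhere. Were
  the point taking it not the bottom of its level, the point below it would share the value of the
  top of level \<open>j\<close>, hence be that top, which has nothing above it.\<close>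

lemma hi_continues:
  assumes "j \<ge> 0"
  obtains j' where "j' \<ge> 0" "P j' (lo j') = P j (hi j) + d"
proof -
  have hi: "(j, hi j) \<in> wedge c q (c + a * q) q" using lo_le_hi assms by (simp add: mem_wedge_iff)
  then have "P j (hi j) + d \<ge> 0" using P_nonneg pos by force
  then obtain j' i' where W: "(j', i') \<in> wedge c q (c + a * q) q" "P j' i' = P j (hi j) + d"
    using P_surj by blast
  have "i' = lo j'"
  proof (rule ccontr)
    assume "i' \<noteq> lo j'"
    then have W': "(j', i' - 1) \<in> wedge c q (c + a * q) q" using W(1) by (auto simp: mem_wedge_iff)
    moreover have "P j' (i' - 1) = P j (hi j)" using W(2) P_add[of j' i' "-1"] by simp
    ultimately have "j' = j" "i' - 1 = hi j" using P_inj hi by blast+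
    with W(1) show False by (simp add: mem_wedge_iff)
  qed
  with W mem_wedge_nonneg that show ?thesis by blast
qed

text \<open>The bottom that continues level \<open>j\<close> lies on some level \<open>j'\<close>.
  Comparing end values shows that \<open>e = j' - j - d\<close> times a factor \<open>X\<close>
  growing with \<open>j\<close> stays bounded by \<open>R\<close>, so the integer \<open>e\<close>
  vanishes once \<open>X > R\<close>.\<close>

lemma eventually_chain:
  obtains J where "J \<ge> 0" "\<And>j. j \<ge> J \<Longrightarrow> P (j + d) (lo (j + d)) = P j (hi j) + d"
proof -
  define \<beta> where "\<beta> = q * b + 2 * d * c"
  define R where "R = 2 * d * (2 * q) + q * a * d\<^sup>2 + \<bar>\<beta>\<bar> * d"
  have R: "R \<ge> 0" using pos by (simp add: R_def)
  show ?thesis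
  proof (rule that[of "\<bar>\<beta>\<bar> + R + 1"])
    fix j assume j: "j \<ge> \<bar>\<beta>\<bar> + R + 1"
    then have "j \<ge> 0" using R by linarith
    then obtain j' where j': "j' \<ge> 0" "P j' (lo j') = P j (hi j) + d" by (rule hi_continues)
    define r where "r = (c * j' - 1) mod q"
    define s where "s = c * j mod q"
    define e where "e = j' - j - d"
    define X where "X = q * a * (j' + j + d) + \<beta>"
    have rs: "0 \<le> r" "r < q" "0 \<le> s" "s < q" using pos by (auto simp: r_def s_def)
    have "q * (2 * P j' (lo j')) = q * (2 * P j (hi j)) + 2 * q * d" using j'(2) by (simp add: algebra_simps)
    then have "q * (a * j'\<^sup>2 + b * j' + 2 * f) + 2 * d * (c * j' + (q - 1 - r))
        = q * (a * j\<^sup>2 + b * j + 2 * f) + 2 * d * (c * j + a * q * j - s) + 2 * q * d"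
      unfolding level_end_values r_def s_def .
    then have eq: "e * X = 2 * d * (1 + r - s) - q * a * d\<^sup>2 - \<beta> * d"
      unfolding X_def e_def \<beta>_def by (simp add: algebra_simps power2_eq_square)
    have "\<bar>2 * d * (1 + r - s)\<bar> \<le> 2 * d * (2 * q)"
      using rs pos by (simp add: abs_mult)
    moreover have "\<bar>q * a * d\<^sup>2\<bar> = q * a * d\<^sup>2" "\<bar>\<beta> * d\<bar> = \<bar>\<beta>\<bar> * d" using pos by (simp_all add: abs_mult)
    ultimately have small: "\<bar>e * X\<bar> \<le> R"
      unfolding eq R_def by linarith
    have "q * a \<ge> 1" using pos by (simp add: int_one_le_iff_zero_less)
    then have "q * a * (j' + j + d) \<ge> 1 * (j' + j + d)"
      using j' \<open>j \<ge> 0\<close> pos by (intro mult_right_mono) auto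
    then have "X \<ge> j + \<beta>" unfolding X_def using j'(1) pos(2) by simp
    then have big: "X > R" using j by linarith
    have "e = 0"
    proof (rule ccontr)
      assume "e \<noteq> 0"
      then have "1 * X \<le> \<bar>e\<bar> * X"
        using big R by (intro mult_right_mono) auto
      moreover have "\<bar>e * X\<bar> = \<bar>e\<bar> * X"
        using big R by (simp add: abs_mult)
      ultimately show False using small big by linarith
    qed
    then have "j' = j + d" by (simp add: e_def)
    with j' show "P (j + d) (lo (j + d)) = P j (hi j) + d" by simp
  qed (use R in auto)
qed

text \<open>Cancelling the quadratic terms leaves a relation between quotients by \<open>q\<close>
  that depends only on \<open>j\<close> modulo \<open>q\<close>, so it can be read off at any
  residue. At \<open>c * j\<close> congruent to 0 and to -1 it gives
  \<open>(c * d - 1) div q = (c * d - 2) div q + 1\<close>, which forces \<open>q\<close> to divide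
  \<open>c * d - 1\<close>.\<close>

lemma chain_relation:
  assumes "coprime c q"
  obtains h where "c * d = 1 + q * h" "b = - (a * d + 2 * h)"
proof -
  obtain J where J: "J \<ge> 0" "\<And>j. j \<ge> J \<Longrightarrow> P (j + d) (lo (j + d)) = P j (hi j) + d"
    using eventually_chain by blast
  have rel: "2 * ((c * (j + d) - 1) div q - c * j div q) = - (a * d + b)" if "j \<ge> J" for j
  proof -
    have "2 * P (j + d) (lo (j + d)) = 2 * P j (hi j) + 2 * d" using J(2)[OF that] by simp
    then have "d * (2 * ((c * (j + d) - 1) div q - c * j div q)) = d * (- (a * d + b))"
      unfolding P unfolding lo_def hi_def by (simp add: algebra_simps power2_eq_square)
    then show ?thesis using pos by simp
  qed
  have "J \<le> J * q" using J(1) pos mult_left_mono[of 1 q J] by simp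
  have "c * (J * q + d) - 1 = (c * d - 1) + (c * J) * q" "c * (J * q) = (c * J) * q"
    by (simp_all add: algebra_simps)
  then have "(c * (J * q + d) - 1) div q = (c * d - 1) div q + c * J" "c * (J * q) div q = c * J"
    using pos by (simp_all only: div_mult_self1 nonzero_mult_div_cancel_right)
  then have h: "2 * ((c * d - 1) div q) = - (a * d + b)"
    using rel[OF \<open>J \<le> J * q\<close>] by simp
  obtain u v where "u * c + v * q = 1"
    using assms bezout_int[of c q] by auto
  define u' where "u' = - u + (\<bar>u\<bar> + J) * q"
  have "(\<bar>u\<bar> + J) * 1 \<le> (\<bar>u\<bar> + J) * q" using J(1) pos by (intro mult_left_mono) auto
  then have "u' \<ge> J" by (simp add: u'_def)
  define t where "t = v + c * (\<bar>u\<bar> + J)"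
  have "c * u' = t * q - 1"
    using \<open>u * c + v * q = 1\<close> by (simp add: u'_def t_def algebra_simps)
  then have "c * (u' + d) - 1 = (c * d - 2) + t * q" "c * u' = - 1 + t * q"
    by (simp_all add: algebra_simps)
  then have "(c * (u' + d) - 1) div q = (c * d - 2) div q + t" "c * u' div q = (- 1) div q + t"
    using pos by (simp_all only: div_mult_self1)
  moreover have "(- 1) div q = - 1" using pos by (simp add: div_eq_minus1)
  ultimately have "2 * ((c * d - 2) div q + 1) = - (a * d + b)"
    using rel[OF \<open>u' \<ge> J\<close>] by simp
  with h have *: "(c * d - 2) div q + 1 = (c * d - 1) div q" by simp
  define h where "h = (c * d - 1) div q"
  have "(c * d - 1) mod q = 0"
  proof (rule ccontr)
    assume "(c * d - 1) mod q \<noteq> 0"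
    then have "0 \<le> (c * d - 1) mod q - 1" "(c * d - 1) mod q - 1 < q"
      using pos pos_mod_bound[of q "c * d - 1"] pos_mod_sign[of q "c * d - 1"] by linarith+
    moreover have "c * d - 2 = ((c * d - 1) mod q - 1) + h * q"
      using mult_div_mod_eq[of q "c * d - 1"] by (simp add: h_def algebra_simps)
    ultimately have "(c * d - 2) div q = h" using pos by (metis add.commute div_mult_self1 div_pos_pos_trivial add_0 less_irrefl)
    with * show False by (simp add: h_def)
  qed
  then have "c * d = 1 + q * h"
    using mult_div_mod_eq[of q "c * d - 1"] by (simp add: h_def)
  moreover have "b = - (a * d + 2 * h)" using h by (simp add: h_def)
  ultimately show ?thesis using that by blast
qed

end

text \<open>Exhaustive evaluation within the bounds that \<open>f < d\<close> and
  \<open>12 * f = a * (d\<^sup>2 - 1)\<close> leave. Here \<open>g\<close> stands for the residue of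
  \<open>- h\<close> modulo \<open>d\<close>, and \<open>vs\<close> lists the doubled values at the
  bottoms of the levels below \<open>d\<close>.\<close>

lemma chain_starts_finite:
  "\<forall>d\<in>set [2..11]. \<forall>a\<in>set [1..12 div (d + 1)]. 12 dvd a * (d * d - 1) \<longrightarrow>
     (\<forall>g\<in>set [0..d - 1]. let f = a * (d * d - 1) div 12;
        vs = map (\<lambda>j. 2 * f - a * (j * (d - j)) + 2 * (g * j mod d)) [0..d - 1]
      in (\<forall>v\<in>set vs. 0 \<le> v) \<and> distinct vs \<longrightarrow> d = 2 \<and> a = 4 \<or> d = 3 \<and> a = (3 :: int))"
  by code_simp

lemma sum_parabola:
  "6 * (\<Sum>j\<in>{0..<int n}. j * (int n - j)) = int n * ((int n)\<^sup>2 - 1)"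
proof -
  have "2 * (\<Sum>j<n. int j) = int n * (int n - 1)"
    by (induction n) (auto simp: algebra_simps)
  moreover have "6 * (\<Sum>j<n. (int j)\<^sup>2) = int n * (int n - 1) * (2 * int n - 1)"
    by (induction n) (auto simp: algebra_simps power2_eq_square)
  moreover have "(\<Sum>j\<in>{0..<int n}. j * (int n - j)) = int n * (\<Sum>j<n. int j) - (\<Sum>j<n. (int j)\<^sup>2)"
    using sum.atLeast_int_lessThan_int_shift[of "\<lambda>j. j * (int n - j)" 0 n]
    by (simp add: lessThan_atLeast0 sum_distrib_left right_diff_distrib sum_subtractf power2_eq_square mult_ac)
  ultimately have "6 * (\<Sum>j\<in>{0..<int n}. j * (int n - j))
      = 3 * int n * (int n * (int n - 1)) - int n * (int n - 1) * (2 * int n - 1)" by simp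
  then show ?thesis by (simp add: algebra_simps power2_eq_square)
qed

locale bij_chain = chain +
  assumes bij: "bij_betw (\<lambda>(j, i). P j i) (wedge c q (c + a * q) q) {0..}"
begin

sublocale bij_levels a "- (a * d + 2 * h)" d q c f P
  by unfold_locales (rule bij)

text \<open>If a level below \<open>d\<close> began with a value of at least \<open>d\<close>, the
  point whose value is smaller by \<open>d\<close> would have a successor, one step up or at the
  bottom \<open>d\<close> levels higher, sharing the value of that beginning. But no successor is
  the bottom of a level below \<open>d\<close>. So the starts inject \<open>{0..<d}\<close> into
  itself.\<close>

lemma starts_bij: "bij_betw (\<lambda>j. P j (lo j)) {0..<d} {0..<d}"
proof -
  let ?W = "wedge c q (c + a * q) q"
  have W: "(j, lo j) \<in> ?W" if "j \<ge> 0" for j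
    using lo_le_hi that by (simp add: mem_wedge_iff)
  have "P j (lo j) < d" if j: "0 \<le> j" "j < d" for j
  proof (rule ccontr)
    assume "\<not> P j (lo j) < d"
    then obtain j' i' where W': "(j', i') \<in> ?W" "P j' i' = P j (lo j) - d"
      using P_surj[of "P j (lo j) - d"] by auto
    show False
    proof (cases "i' < hi j'")
      case True
      then have "(j', i' + 1) \<in> ?W" using W'(1) by (simp add: mem_wedge_iff)
      moreover have "P j' (i' + 1) = P j (lo j)" using W'(2) P_add[of j' i' 1] by simp
      ultimately have "j' = j" "i' + 1 = lo j" using P_inj W j by blast+
      with W'(1) show False by (simp add: mem_wedge_iff)
    next
      case False
      with W'(1) have "i' = hi j'" by (simp add: mem_wedge_iff)
      then have "P (j' + d) (lo (j' + d)) = P j (lo j)" using W'(2) P_lo_add_d[of j'] by simp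
      moreover have "j' \<ge> 0" using W'(1) mem_wedge_nonneg by blast
      ultimately have "j' + d = j" using P_inj(1) W j pos by (metis add_nonneg_nonneg less_imp_le)
      with j \<open>j' \<ge> 0\<close> show False by simp
    qed
  qed
  then have "(\<lambda>j. P j (lo j)) ` {0..<d} \<subseteq> {0..<d}"
    using P_nonneg W by fastforce
  moreover have "inj_on (\<lambda>j. P j (lo j)) {0..<d}"
    using P_inj W by (intro inj_onI) (metis atLeastLessThan_iff)
  ultimately show ?thesis
    by (simp add: bij_betw_def endo_inj_surj)
qed

lemma good: "good_start a d f"
proof -
  have cop: "coprime h d"
  proof (rule coprimeI)
    fix x assume "x dvd h" "x dvd d"
    then have "x dvd c * d - q * h" by simp
    with cd show "is_unit x" by simp
  qed
  let ?E = "\<lambda>j. (- h * j) mod d"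
  \<comment> \<open>Multiplication by \<open>- h\<close> permutes the residues modulo
    \<open>d\<close>. The residues and the start values thus have the same sum, and both cancel when
    the formula \<open>P_lo\<close> is summed.\<close>
  have "inj_on ?E {0..<d}"
  proof (rule inj_onI)
    fix x y assume xy: "x \<in> {0..<d}" "y \<in> {0..<d}" "?E x = ?E y"
    then have "d dvd h * (x - y)" by (simp add: mod_eq_dvd_iff algebra_simps dvd_diff_commute)
    then have "d dvd x - y" using cop by (simp add: coprime_commute coprime_dvd_mult_right_iff)
    then have "x mod d = y mod d" by (simp add: mod_eq_dvd_iff)
    with xy show "x = y" by simp
  qed
  then have "bij_betw ?E {0..<d} {0..<d}"
    using pos by (intro bij_betw_imageI endo_inj_surj) auto
  then have sumE: "(\<Sum>j\<in>{0..<d}. ?E j) = \<Sum>{0..<d}"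
    by (rule sum.reindex_bij_betw[of _ _ _ "\<lambda>x. x"])
  have sumP: "(\<Sum>j\<in>{0..<d}. P j (lo j)) = \<Sum>{0..<d}"
    using starts_bij by (rule sum.reindex_bij_betw[of _ _ _ "\<lambda>x. x"])
  have "2 * (\<Sum>j\<in>{0..<d}. P j (lo j)) = (\<Sum>j\<in>{0..<d}. 2 * f - a * (j * (d - j)) + 2 * ?E j)"
    unfolding sum_distrib_left by (intro sum.cong refl P_lo) auto
  also have "\<dots> = 2 * f * d - a * (\<Sum>j\<in>{0..<d}. j * (d - j)) + 2 * (\<Sum>j\<in>{0..<d}. ?E j)"
    using pos by (simp add: sum.distrib sum_subtractf sum_distrib_left)
  finally have "2 * f * d = a * (\<Sum>j\<in>{0..<d}. j * (d - j))"
    using sumE sumP by simp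
  then have "d * (2 * f) = a * (\<Sum>j\<in>{0..<d}. j * (d - j))" by (simp only: mult_ac)
  then have "d * (12 * f) = a * (6 * (\<Sum>j\<in>{0..<d}. j * (d - j)))" by simp
  also have "\<dots> = d * (a * (d\<^sup>2 - 1))"
    using sum_parabola[of "nat d"] pos by simp
  finally have f: "12 * f = a * (d\<^sup>2 - 1)" using pos by simp
  have v: "2 * P j (lo j) = 2 * f - a * (j * (d - j)) + 2 * ?E j" "0 \<le> P j (lo j)" "P j (lo j) < d"
    if "0 \<le> j" "j < d" for j
    using P_lo[OF that] bij_betwE[OF starts_bij] that by auto
  \<comment> \<open>Level 0 starts at the value \<open>f\<close>. Together with
    \<open>12 * f = a * (d - 1) * (d + 1)\<close> this bounds \<open>a * (d + 1)\<close> by 12 once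
    \<open>d > 1\<close>.\<close>
  have "f < d"
    using v[of 0] pos by auto
  show ?thesis
  proof (cases "d = 1")
    case True
    with f show ?thesis by (simp add: good_start_def)
  next
    case False
    with pos have "d \<ge> 2" by simp
    have "(a * (d + 1)) * (d - 1) \<le> 12 * (d - 1)"
      using f \<open>f < d\<close> by (simp add: algebra_simps power2_eq_square)
    then have ad: "a * (d + 1) \<le> 12" using \<open>d \<ge> 2\<close> by (simp only: mult_le_cancel_right)
    have "1 * (d + 1) \<le> a * (d + 1)" using pos by (intro mult_right_mono) auto
    with ad have "d \<le> 11" by simp
    have "a \<le> 12 div (d + 1)" using ad le_div_add_iff[of "d + 1" a 12 0] pos by (simp add: mult.commute)
    define g where "g = (- h) mod d"
    define vs where "vs = map (\<lambda>j. 2 * f - a * (j * (d - j)) + 2 * (g * j mod d)) [0..d - 1]"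
    have vs: "vs = map (\<lambda>j. 2 * P j (lo j)) [0..d - 1]"
      unfolding vs_def g_def using v(1) by (intro map_cong refl) (auto simp: mod_mult_left_eq)
    have "inj_on (\<lambda>j. 2 * P j (lo j)) {0..d - 1}"
      using bij_betw_imp_inj_on[OF starts_bij] by (auto simp: inj_on_def)
    then have "(\<forall>v\<in>set vs. 0 \<le> v) \<and> distinct vs"
      unfolding vs using v(2) by (auto simp: distinct_map)
    moreover have "f = a * (d * d - 1) div 12" "12 dvd a * (d * d - 1)"
      using f by (auto simp: power2_eq_square dvd_def intro: exI[of _ f])
    moreover have "d \<in> set [2..11]" "a \<in> set [1..12 div (d + 1)]" "g \<in> set [0..d - 1]"
      using \<open>d \<ge> 2\<close> \<open>d \<le> 11\<close> pos \<open>a \<le> 12 div (d + 1)\<close>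
      unfolding set_upto g_def by simp_all
    ultimately have "d = 2 \<and> a = 4 \<or> d = 3 \<and> a = 3"
      using chain_starts_finite unfolding vs_def Let_def by blast
    with f show ?thesis by (auto simp: good_start_def)
  qed
qed

end

section \<open>Growth of a packing polynomial\<close>

text \<open>Up to a large \<open>N\<close>, progression \<open>k\<close> contains at least
  \<open>(N - s k) / D k\<close> numbers. All of them together are distinct elements of
  \<open>{0..N}\<close>, so the densities \<open>1 / D k\<close> cannot add up to more than
  1.\<close>

lemma disjoint_progressions_density:
  fixes s D :: "nat \<Rightarrow> int"
  assumes D: "\<And>k. D k > 0" and s: "\<And>k. s k \<ge> 0"
    and inj: "inj (\<lambda>(k, t :: nat). s k + int t * D k)"
  shows "(\<Sum>k<K. 1 / real_of_int (D k)) \<le> 1"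
proof (rule ccontr)
  define \<sigma> where "\<sigma> = (\<Sum>k<K. 1 / real_of_int (D k))"
  define \<tau> where "\<tau> = (\<Sum>k<K. real_of_int (s k) / real_of_int (D k))"
  assume "\<not> (\<Sum>k<K. 1 / real_of_int (D k)) \<le> 1"
  then have "\<sigma> > 1" by (simp add: \<sigma>_def)
  then obtain N :: nat where N: "1 + \<tau> < real N * (\<sigma> - 1)"
    using reals_Archimedean3[of "\<sigma> - 1"] by auto
  define T where "T k = {t :: nat. s k + int t * D k \<le> int N}" for k
  have T: "finite (T k)" "(real N - s k) / D k \<le> card (T k)" for k
  proof -
    define w where "w = (int N - s k) div D k"
    have "T k = {t. int t \<le> w}"
      using le_div_add_iff[OF D, of _ "int N - s k" k 0] unfolding T_def w_def
      by (auto simp: algebra_simps)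
    also have "\<dots> = {..<nat (w + 1)}" by auto
    finally have Tk: "T k = {..<nat (w + 1)}" .
    then show "finite (T k)" by simp
    have "int N - s k < D k * (w + 1)"
      using le_div_add_iff[OF D, of "w + 1" "int N - s k" k 0] by (simp add: w_def)
    then have "real_of_int (int N - s k) \<le> real_of_int (D k * (w + 1))" by linarith
    then have "(real N - s k) / D k \<le> real_of_int (w + 1)"
      using D[of k] by (simp add: field_simps)
    also have "\<dots> \<le> card (T k)" using Tk by simp
    finally show "(real N - s k) / D k \<le> card (T k)" .
  qed
  have "(\<lambda>(k, t). s k + int t * D k) ` (SIGMA k:{..<K}. T k) \<subseteq> {0..int N}"
    using s D by (auto simp: T_def less_imp_le)
  then have "card (SIGMA k:{..<K}. T k) \<le> card {0..int N}"
    using inj by (intro card_inj_on_le) (auto intro: inj_on_subset)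
  then have "(\<Sum>k<K. card (T k)) \<le> N + 1"
    using T(1) by (simp add: nat_add_distrib)
  then have "real (\<Sum>k<K. card (T k)) \<le> real (N + 1)" by (rule of_nat_mono)
  moreover have "(\<Sum>k<K. (real N - s k) / D k) \<le> (\<Sum>k<K. real (card (T k)))"
    using T(2) by (intro sum_mono)
  ultimately have "(\<Sum>k<K. (real N - s k) / D k) \<le> real N + 1" by simp
  moreover have "(\<Sum>k<K. (real N - s k) / D k) = real N * \<sigma> - \<tau>"
    unfolding \<sigma>_def \<tau>_def by (simp add: diff_divide_distrib sum_subtractf sum_distrib_left)
  ultimately show False using N by (simp add: algebra_simps)
qed

text \<open>The densities \<open>1 / (l + k * b)\<close> dominate a multiple of the harmonic series,
  whereas disjointness would bound their partial sums by 1.\<close>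

lemma no_disjoint_progressions:
  fixes s :: "nat \<Rightarrow> int" and l b :: int
  assumes "l > 0" "b \<ge> 0" and s: "\<And>k. s k \<ge> 0"
  shows "\<not> inj (\<lambda>(k, t :: nat). s k + int t * (l + int k * b))"
proof
  assume inj: "inj (\<lambda>(k, t :: nat). s k + int t * (l + int k * b))"
  have pos: "l + int k * b > 0" for k
    using assms by (simp add: add_pos_nonneg)
  have "(\<Sum>k<K. 1 / real_of_int (l + int k * b)) \<le> 1" for K
    by (rule disjoint_progressions_density[OF pos s inj])
  then have "summable (\<lambda>k. 1 / real_of_int (l + int k * b))"
    using pos by (intro summableI_nonneg_bounded[where x = 1]) (simp_all add: less_imp_le del: of_int_add of_int_mult)
  moreover have "norm (inverse (real (Suc k)) * inverse (real_of_int (l + b))) \<le> 1 / real_of_int (l + int k * b)" for k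
  proof -
    have "l + int k * b \<le> int (Suc k) * (l + b)"
      using assms by (simp add: algebra_simps)
    then have "real_of_int (l + int k * b) \<le> real_of_int (int (Suc k) * (l + b))" by linarith
    then have "1 / real_of_int (int (Suc k) * (l + b)) \<le> 1 / real_of_int (l + int k * b)"
      using pos[of k] by (intro divide_left_mono) (auto intro!: mult_pos_pos add_pos_nonneg simp: assms)
    then show ?thesis using assms by (simp add: divide_inverse mult_ac)
  qed
  ultimately have "summable (\<lambda>k. inverse (real (Suc k)) * inverse (real_of_int (l + b)))"
    by (rule summable_comparison_test'[where N = 0])
  then have "summable (\<lambda>k. inverse (real (Suc k)) * inverse (real_of_int (l + b)) * real_of_int (l + b))"
    by (rule summable_mult2)
  then have "summable (\<lambda>k. inverse (real (Suc k)))"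
    using assms by (simp add: mult.assoc del: of_nat_Suc of_int_add)
  then show False
    using not_summable_harmonic[where 'a = real] by (subst (asm) summable_Suc_iff) simp
qed

lemma card_residue_class_le:
  fixes V M r :: int
  assumes "M > 0" "V \<ge> 0"
  shows "int (card {k \<in> {0..V}. k mod M = r}) \<le> V div M + 1"
proof -
  have "card {k \<in> {0..V}. k mod M = r} \<le> card {0..V div M}"
  proof (rule card_inj_on_le)
    show "inj_on (\<lambda>k. k div M) {k \<in> {0..V}. k mod M = r}"
      by (rule inj_onI) (metis (mono_tags, lifting) div_mult_mod_eq mem_Collect_eq)
    show "(\<lambda>k. k div M) ` {k \<in> {0..V}. k mod M = r} \<subseteq> {0..V div M}"
      using assms by (auto simp: zdiv_mono1 pos_imp_zdiv_nonneg_iff)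
  qed simp
  moreover have "0 \<le> V div M" using assms by (simp add: pos_imp_zdiv_nonneg_iff)
  ultimately show ?thesis by simp
qed

text \<open>An integer-valued quadratic polynomial may have half-integral coefficients at the
  squares and the linear terms, but not at \<open>x * y\<close> or in the constant; hence the factor
  2 in front of \<open>p\<close>, \<open>B\<close> and \<open>F\<close>.\<close>

locale packing =
  fixes n m A B C D E F :: int and p :: "int \<Rightarrow> int \<Rightarrow> int"
  assumes nm: "n > 0" "m > 0"
    and p: "\<And>x y. 2 * p x y = A * x\<^sup>2 + 2 * B * x * y + C * y\<^sup>2 + D * x + E * y + 2 * F"
    and bij: "bij_betw (\<lambda>(x, y). p x y) (wedge 0 1 n m) {0..}"
begin

abbreviation "W \<equiv> wedge 0 1 n m"
definition "Q x y = A * x\<^sup>2 + 2 * B * x * y + C * y\<^sup>2"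
text \<open>The polar form of \<open>Q\<close>:
  \<open>Q (x + u) (y + v) = Q x y + 2 * G x y u v + Q u v\<close>.\<close>

definition "G x y u v = A * x * u + B * (x * v + y * u) + C * y * v"

lemma W_iff: "(x, y) \<in> W \<longleftrightarrow> 0 \<le> y \<and> m * y \<le> n * x"
  by (simp add: wedge_def)

lemma W_add: "(x, y) \<in> W \<Longrightarrow> (x', y') \<in> W \<Longrightarrow> (x + x', y + y') \<in> W"
  by (simp add: W_iff distrib_left)

lemma W_scale: "(x, y) \<in> W \<Longrightarrow> t \<ge> 0 \<Longrightarrow> (t * x, t * y) \<in> W"
  using mult_left_mono[of "m * y" "n * x" t] by (simp add: W_iff mult_ac)

lemma p_nonneg: "(x, y) \<in> W \<Longrightarrow> p x y \<ge> 0"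
  using bij_betwE[OF bij] by fastforce

lemma p_inj:
  assumes "(x, y) \<in> W" "(x', y') \<in> W" "p x y = p x' y'"
  shows "x = x' \<and> y = y'"
proof -
  have "(x, y) = (x', y')"
    using assms by (intro inj_onD[OF bij_betw_imp_inj_on[OF bij]]) auto
  then show ?thesis by auto
qed

lemma p_surj:
  assumes "w \<ge> 0" obtains x y where "(x, y) \<in> W" "p x y = w"
proof -
  have "w \<in> (\<lambda>(x, y). p x y) ` W"
    using assms bij_betw_imp_surj_on[OF bij] by simp
  then show ?thesis using that by auto
qed

lemma p_shift: "2 * p (x + u) (y + v) = 2 * p x y + (2 * G x y u v + D * u + E * v) + Q u v"
  unfolding p Q_def G_def by (simp add: algebra_simps power2_eq_square)

lemma Q_nonneg:
  assumes "(u, v) \<in> W" shows "Q u v \<ge> 0"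
proof -
  have "- Q u v * (int N)\<^sup>2 \<le> (D * u + E * v) * int N + 2 * F" for N
  proof -
    have "2 * p (int N * u) (int N * v) \<ge> 0"
      using p_nonneg[OF W_scale[OF assms]] by simp
    then show ?thesis
      unfolding p Q_def by (simp add: algebra_simps power2_eq_square)
  qed
  then have "- Q u v \<le> 0" by (rule int_quadratic_le_linear[where K = 0])
  then show ?thesis by simp
qed

text \<open>If the quadratic form vanishes in a direction \<open>(u, v)\<close> of the wedge, then \<open>p\<close> runs through
  arithmetic progressions along the rays in that direction, and their differences grow too slowly
  for the progressions to be disjoint.\<close>

lemma Q_pos:
  assumes uv: "(u, v) \<in> W" "(u, v) \<noteq> (0, 0)" shows "Q u v > 0"
proof (rule ccontr)
  assume "\<not> Q u v > 0"
  with Q_nonneg[OF uv(1)] have Q0: "Q u v = 0" by simp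
  \<comment> \<open>A boundary direction of the wedge that is not parallel to \<open>(u, v)\<close>,
    as \<open>det\<close> confirms.\<close>
  define x where "x = (if v = 0 then m else 1)"
  define y where "y = (if v = 0 then n else 0)"
  have xy: "(x, y) \<in> W" using nm by (simp add: x_def y_def W_iff)
  have det: "x * v - y * u \<noteq> 0"
    using uv nm by (auto simp: x_def y_def)
  \<comment> \<open>Otherwise \<open>Q\<close>, which is affine in \<open>t\<close> along
    \<open>(x, y) + t * (u, v)\<close>, would become negative inside the wedge.\<close>
  have "G x y u v \<ge> 0"
  proof (rule ccontr)
    assume "\<not> G x y u v \<ge> 0"
    define t where "t = Q x y + 1"
    have "t \<ge> 0" using Q_nonneg[OF xy] by (simp add: t_def)
    then have "Q (x + t * u) (y + t * v) \<ge> 0"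
      using W_add[OF xy W_scale[OF uv(1)]] Q_nonneg by blast
    also have "Q (x + t * u) (y + t * v) = Q x y + 2 * t * G x y u v + t\<^sup>2 * Q u v"
      unfolding Q_def G_def by (simp add: algebra_simps power2_eq_square)
    finally have "0 \<le> Q x y + t * (2 * G x y u v)" using Q0 by simp
    moreover have "t * (2 * G x y u v) \<le> t * (- 1)"
      using \<open>t \<ge> 0\<close> \<open>\<not> G x y u v \<ge> 0\<close> by (intro mult_left_mono) auto
    ultimately show False by (simp add: t_def)
  qed
  define l where "l = p u v - p 0 0"
  have l: "2 * l = D * u + E * v"
    using p_shift[of 0 u 0 v] Q0 by (simp add: l_def G_def)
  have step: "p (k * x + t * u) (k * y + t * v) = p (k * x) (k * y) + t * (l + k * G x y u v)" for k t
  proof -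
    have "G (k * x) (k * y) (t * u) (t * v) = t * k * G x y u v" "Q (t * u) (t * v) = t\<^sup>2 * Q u v"
      by (simp_all add: G_def Q_def algebra_simps power2_eq_square)
    then have "2 * p (k * x + t * u) (k * y + t * v)
        = 2 * p (k * x) (k * y) + (2 * (t * k * G x y u v) + t * (D * u + E * v))"
      unfolding p_shift using Q0 by (simp add: algebra_simps)
    then show ?thesis unfolding l[symmetric] by (simp add: algebra_simps)
  qed
  have points: "(int k * x + int t * u, int k * y + int t * v) \<in> W" for k t :: nat
    using W_add[OF W_scale[OF xy] W_scale[OF uv(1)]] by simp
  \<comment> \<open>Along the ray from the origin \<open>p\<close> changes by \<open>l\<close> per
    step, so \<open>l = 0\<close> repeats a value and \<open>l < 0\<close> leads below zero.\<close>
  have "l > 0"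
  proof (rule ccontr)
    assume "\<not> l > 0"
    define t where "t = p 0 0 + 1"
    have t: "t > 0" using p_nonneg[of 0 0] by (simp add: t_def W_iff)
    have val: "p (t * u) (t * v) = p 0 0 + t * l" using step[of 0 t] by simp
    have tuv: "(t * u, t * v) \<in> W" using W_scale[OF uv(1)] t by simp
    show False
    proof (cases "l = 0")
      case True
      then have "t * u = 0 \<and> t * v = 0" using p_inj[OF tuv, of 0 0] val by (simp add: W_iff)
      with t uv(2) show False by simp
    next
      case False
      then have "t * l \<le> t * (- 1)" using t \<open>\<not> l > 0\<close> by (intro mult_left_mono) auto
      then have "p (t * u) (t * v) < 0" using val by (simp add: t_def)
      with p_nonneg[OF tuv] show False by simp
    qed
  qed
  have "inj (\<lambda>(k, t :: nat). p (int k * x) (int k * y) + int t * (l + int k * G x y u v))"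
  proof (rule injI, clarify)
    fix k t k' t' :: nat
    assume "p (int k * x) (int k * y) + int t * (l + int k * G x y u v)
      = p (int k' * x) (int k' * y) + int t' * (l + int k' * G x y u v)"
    then have "int k * x + int t * u = int k' * x + int t' * u"
        "int k * y + int t * v = int k' * y + int t' * v"
      using p_inj[OF points points] unfolding step[symmetric] by blast+
    then have *: "(int k - int k') * x = (int t' - int t) * u" "(int k - int k') * y = (int t' - int t) * v"
      by (simp_all add: algebra_simps)
    have "(int k - int k') * (x * v - y * u) = ((int k - int k') * x) * v - ((int k - int k') * y) * u"
      by (simp add: algebra_simps)
    also have "\<dots> = 0" unfolding * by simp
    finally have "k = k'" using det by simp
    with * uv(2) show "k = k' \<and> t = t'" by auto
  qed
  moreover have "p (int k * x) (int k * y) \<ge> 0" for k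
    using p_nonneg W_scale[OF xy] by simp
  ultimately show False
    using no_disjoint_progressions[of l "G x y u v" "\<lambda>k. p (int k * x) (int k * y)"]
      \<open>l > 0\<close> \<open>G x y u v \<ge> 0\<close> by simp
qed

text \<open>In the coordinates \<open>X = n * x - m * y\<close> and \<open>y\<close> the wedge lies
  in the quadrant, and \<open>n\<^sup>2 * Q\<close> has the matrix with rows \<open>A, S\<close> and
  \<open>S, R\<close>. For \<open>S \<ge> 0\<close> all terms are nonnegative; for
  \<open>S < 0\<close> positivity of \<open>Q\<close> on the wedge makes the matrix positive
  definite.\<close>

lemma Q_growth:
  obtains g where "g > 0" "\<And>x y. (x, y) \<in> W \<Longrightarrow> x\<^sup>2 + y\<^sup>2 \<le> g * Q x y"
proof -
  define R where "R = Q m n"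
  define S where "S = A * m + B * n"
  have A: "A > 0" using Q_pos[of 1 0] nm by (simp add: W_iff Q_def)
  have R: "R > 0" using Q_pos[of m n] nm by (simp add: W_iff R_def)
  define g where "g = (2 * m\<^sup>2 + n\<^sup>2 + 2) * (A + R)"
  have *: "x\<^sup>2 + y\<^sup>2 \<le> g * Q x y" if W: "(x, y) \<in> W" for x y
  proof -
    define X where "X = n * x - m * y"
    have X: "X \<ge> 0" "y \<ge> 0" using W by (simp_all add: X_def W_iff)
    have n2Q: "n\<^sup>2 * Q x y = A * X\<^sup>2 + 2 * S * X * y + R * y\<^sup>2"
      unfolding Q_def X_def R_def S_def by (simp add: algebra_simps power2_eq_square)
    have bound: "X\<^sup>2 + y\<^sup>2 \<le> (A + R) * (n\<^sup>2 * Q x y)"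
    proof (cases "S \<ge> 0")
      case True
      have "1 * X\<^sup>2 \<le> A * X\<^sup>2" "1 * y\<^sup>2 \<le> R * y\<^sup>2" using A R by (intro mult_right_mono; simp)+
      moreover have "2 * S * X * y \<ge> 0" using True X by simp
      ultimately have "X\<^sup>2 + y\<^sup>2 \<le> n\<^sup>2 * Q x y" unfolding n2Q by simp
      also have "\<dots> = 1 * (n\<^sup>2 * Q x y)" by simp
      also have "\<dots> \<le> (A + R) * (n\<^sup>2 * Q x y)" using A R Q_nonneg[OF W] by (intro mult_right_mono) auto
      finally show ?thesis .
    next
      case False
      \<comment> \<open>In the coordinates \<open>(X, y)\<close> this point is \<open>n\<close>
        times \<open>(- S, A)\<close>, where \<open>A * X + S * y\<close> vanishes. It lies in the
        wedge because \<open>S < 0\<close>, and \<open>Q\<close> there is \<open>A\<close> times the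
        determinant \<open>A * R - S\<^sup>2\<close>.\<close>
      have "(- S + A * m, A * n) \<in> W" using False A nm mult_nonneg_nonneg[of "- S" n] by (simp add: W_iff algebra_simps)
      then have "Q (- S + A * m) (A * n) > 0" using Q_pos A nm by simp
      also have "Q (- S + A * m) (A * n) = A * (A * R - S\<^sup>2)"
        unfolding Q_def R_def S_def by (simp add: algebra_simps power2_eq_square)
      finally have "A * R - S\<^sup>2 \<ge> 1" using A by (simp add: zero_less_mult_iff)
      then have "1 * (X\<^sup>2 + y\<^sup>2) \<le> (A * R - S\<^sup>2) * (X\<^sup>2 + y\<^sup>2)" by (intro mult_right_mono) auto
      also have "\<dots> \<le> (A * X + S * y)\<^sup>2 + (S * X + R * y)\<^sup>2 + (A * R - S\<^sup>2) * (X\<^sup>2 + y\<^sup>2)" by simp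
      \<comment> \<open>Cayley-Hamilton: the trace times the form is the squared length of the image
        vector plus the determinant times \<open>X\<^sup>2 + y\<^sup>2\<close>.\<close>
      also have "\<dots> = (A + R) * (n\<^sup>2 * Q x y)"
        unfolding n2Q by (simp add: algebra_simps power2_eq_square)
      finally show ?thesis by simp
    qed
    have "n\<^sup>2 * x\<^sup>2 = (X + m * y)\<^sup>2" by (simp add: X_def power_mult_distrib)
    also have "\<dots> \<le> 2 * X\<^sup>2 + 2 * m\<^sup>2 * y\<^sup>2"
      using zero_le_power2[of "X - m * y"] by (simp add: algebra_simps power2_eq_square)
    finally have "n\<^sup>2 * (x\<^sup>2 + y\<^sup>2) \<le> 2 * X\<^sup>2 + (2 * m\<^sup>2 + n\<^sup>2) * y\<^sup>2" by (simp add: algebra_simps)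
    also have "\<dots> \<le> (2 * m\<^sup>2 + n\<^sup>2 + 2) * (X\<^sup>2 + y\<^sup>2)" by (simp add: algebra_simps)
    also have "\<dots> \<le> (2 * m\<^sup>2 + n\<^sup>2 + 2) * ((A + R) * (n\<^sup>2 * Q x y))"
      using bound by (intro mult_left_mono) auto
    also have "\<dots> = n\<^sup>2 * (g * Q x y)" by (simp add: g_def mult_ac)
    finally show ?thesis using nm by simp
  qed
  have "2 * m\<^sup>2 + n\<^sup>2 + 2 > 0" by (simp add: add_nonneg_pos)
  then have "g > 0" using A R by (simp add: g_def)
  then show ?thesis using * that by blast
qed

text \<open>A translation changes \<open>p\<close> by a function of degree one, and the quadratic
  growth of \<open>Q\<close> lets the fraction \<open>1 / e\<close> of \<open>p\<close> absorb it up
  to a constant.\<close>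

lemma p_shift_bound:
  assumes "e > 0"
  shows "\<exists>c. \<forall>x y. (x, y) \<in> W \<longrightarrow> e * p (x + u) (y + v) \<le> (e + 1) * p x y + c"
proof -
  obtain g where g: "g > 0" "\<And>x y. (x, y) \<in> W \<Longrightarrow> x\<^sup>2 + y\<^sup>2 \<le> g * Q x y"
    using Q_growth by blast
  define k0 where "k0 = e * (D * u + E * v + Q u v) - 2 * F"
  define k1 where "k1 = g * (2 * e * (A * u + B * v) - D)"
  define k2 where "k2 = g * (2 * e * (B * u + C * v) - E)"
  have "e * p (x + u) (y + v) \<le> (e + 1) * p x y + (k1\<^sup>2 + k2\<^sup>2 + \<bar>k0\<bar>)" if W: "(x, y) \<in> W" for x y
  proof -
    have "2 * (e * p (x + u) (y + v) - (e + 1) * p x y) = e * (2 * p (x + u) (y + v)) - (e + 1) * (2 * p x y)"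
      by (simp add: algebra_simps)
    also have "\<dots> = e * (2 * G x y u v + D * u + E * v + Q u v) - 2 * p x y"
      unfolding p_shift by (simp add: algebra_simps)
    finally have "g * (2 * (e * p (x + u) (y + v) - (e + 1) * p x y))
      = g * (e * (2 * G x y u v + D * u + E * v + Q u v) - 2 * p x y)" by (simp only:)
    also have "\<dots> = k1 * x + k2 * y + g * k0 - g * Q x y"
      unfolding p by (simp add: Q_def G_def k0_def k1_def k2_def algebra_simps)
    finally have "g * (2 * (e * p (x + u) (y + v) - (e + 1) * p x y)) = k1 * x + k2 * y + g * k0 - g * Q x y" .
    moreover have sq: "k * t - t\<^sup>2 \<le> k\<^sup>2" for k t :: int
    proof -
      have "0 \<le> (2 * t - k)\<^sup>2 + 3 * k\<^sup>2" by simp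
      also have "\<dots> = 4 * (k\<^sup>2 - (k * t - t\<^sup>2))" by (simp add: algebra_simps power2_eq_square)
      finally show ?thesis by simp
    qed
    have "k1 * x - x\<^sup>2 \<le> k1\<^sup>2" "k2 * y - y\<^sup>2 \<le> k2\<^sup>2" by (rule sq)+
    moreover have "g * k0 \<le> g * \<bar>k0\<bar>" "1 * k1\<^sup>2 \<le> g * k1\<^sup>2" "1 * k2\<^sup>2 \<le> g * k2\<^sup>2" "0 \<le> g * \<bar>k0\<bar>" "0 \<le> g * k1\<^sup>2" "0 \<le> g * k2\<^sup>2"
      using g(1) by (simp_all only: mult_le_cancel_right mult_le_cancel_left) (auto simp: not_less)
    ultimately have "g * (2 * (e * p (x + u) (y + v) - (e + 1) * p x y)) \<le> g * (2 * (k1\<^sup>2 + k2\<^sup>2 + \<bar>k0\<bar>))"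
      using g(2)[OF W] by (simp add: algebra_simps)
    then show ?thesis using g(1) by simp
  qed
  then show ?thesis by blast
qed

end

section \<open>Degeneracy of the quadratic form\<close>

lemma odd_dvd_double_iff:
  fixes M z :: int
  assumes "odd M" shows "M dvd 2 * z \<longleftrightarrow> M dvd z"
  using coprime_dvd_mult_right_iff[of M 2 z] assms by simp

context packing
begin

text \<open>Each of the \<open>N + 1\<close> points of value at most \<open>N\<close> is translated
  by a bounded vector into the prescribed class, which raises its value by at most the factor
  \<open>(e + 1) / e\<close> and a constant. The original residues determine the translation, so at
  most \<open>M\<^sup>2\<close> points share an image.\<close>

lemma class_density:
  assumes "M > 0" "e > 0"
  shows "\<exists>c. \<forall>N\<ge>0. N + 1 \<le> M\<^sup>2 *
    int (card {(x, y) \<in> W. x mod M = r mod M \<and> y mod M = s mod M \<and> e * p x y \<le> (e + 1) * N + c})"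
proof -
  define U where "U = {0..<M + m * M} \<times> {0..<M}"
  obtain c0 where c0: "\<And>u v x y. (x, y) \<in> W \<Longrightarrow> e * p (x + u) (y + v) \<le> (e + 1) * p x y + c0 u v"
    using p_shift_bound[OF assms(2)] by metis
  define c where "c = (\<Sum>(u, v)\<in>U. \<bar>c0 u v\<bar>)"
  have fin: "finite U" by (simp add: U_def)
  have c: "e * p (x + u) (y + v) \<le> (e + 1) * p x y + c" if "(x, y) \<in> W" "(u, v) \<in> U" for x y u v
  proof -
    have "\<bar>c0 u v\<bar> \<le> c"
      using member_le_sum[of "(u, v)" U "\<lambda>(u, v). \<bar>c0 u v\<bar>"] that(2) fin by (auto simp: c_def)
    then show ?thesis using c0[OF that(1), of u v] by linarith
  qed
  have "N + 1 \<le> M\<^sup>2 * int (card {(x, y) \<in> W. x mod M = r mod M \<and> y mod M = s mod M \<and> e * p x y \<le> (e + 1) * N + c})"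
    (is "_ \<le> _ * int (card ?T)") if N: "N \<ge> 0" for N
  proof -
    define V where "V = {z \<in> W. (case z of (x, y) \<Rightarrow> p x y) \<le> N}"
    have "bij_betw (\<lambda>(x, y). p x y) V {0..N}"
      unfolding bij_betw_def
    proof
      show "inj_on (\<lambda>(x, y). p x y) V"
        using bij_betw_imp_inj_on[OF bij] by (rule inj_on_subset) (auto simp: V_def)
      show "(\<lambda>(x, y). p x y) ` V = {0..N}"
      proof (intro equalityI subsetI)
        fix w assume "w \<in> {0..N}"
        then obtain x y where "(x, y) \<in> W" "p x y = w" using p_surj[of w] by auto
        then show "w \<in> (\<lambda>(x, y). p x y) ` V" using \<open>w \<in> {0..N}\<close> by (force simp: V_def)
      qed (auto simp: V_def dest: p_nonneg)
    qed
    then have V: "int (card V) = N + 1" using N by (simp add: bij_betw_same_card)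
    have "finite ?T"
    proof (rule finite_imageD)
      have "(\<lambda>(x, y). p x y) ` ?T \<subseteq> {0..(e + 1) * N + c}"
      proof clarify
        fix x y assume xy: "(x, y) \<in> W" "e * p x y \<le> (e + 1) * N + c"
        have "1 * p x y \<le> e * p x y" using assms(2) p_nonneg[OF xy(1)] by (intro mult_right_mono) auto
        with xy p_nonneg[OF xy(1)] show "p x y \<in> {0..(e + 1) * N + c}" by simp
      qed
      then show "finite ((\<lambda>(x, y). p x y) ` ?T)" by (rule finite_subset) simp
      show "inj_on (\<lambda>(x, y). p x y) ?T"
        using bij_betw_imp_inj_on[OF bij] by (rule inj_on_subset) auto
    qed
    \<comment> \<open>The extra \<open>m * M\<close> in the first coordinate puts the translation
      vector itself into the wedge; the recorded residues make the map injective.\<close>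
    define \<phi> where "\<phi> = (\<lambda>(x, y). ((x + ((r - x) mod M + m * M), y + (s - y) mod M), (x mod M, y mod M)))"
    have "\<phi> ` V \<subseteq> ?T \<times> ({0..<M} \<times> {0..<M})"
    proof
      fix z assume "z \<in> \<phi> ` V"
      then obtain x y where xy: "(x, y) \<in> W" "p x y \<le> N" "z = \<phi> (x, y)" by (auto simp: V_def)
      define u where "u = (r - x) mod M + m * M"
      define v where "v = (s - y) mod M"
      have uv: "0 \<le> v" "v < M" "m * M \<le> u" "u < M + m * M"
        using assms by (auto simp: u_def v_def)
      have "m * v \<le> m * M" using uv nm by simp
      also have "\<dots> \<le> u" by fact
      also have "\<dots> \<le> n * u"
      proof -
        have "0 \<le> m * M" using nm assms by simp
        then have "0 \<le> u" using uv by linarith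
        then show ?thesis using nm mult_right_mono[of 1 n u] by simp
      qed
      finally have "(u, v) \<in> W" using uv by (simp add: W_iff)
      then have W: "(x + u, y + v) \<in> W" using W_add xy(1) by blast
      have "0 \<le> m * M" using nm assms by simp
      then have "(u, v) \<in> U" using uv by (auto simp: U_def)
      then have "e * p (x + u) (y + v) \<le> (e + 1) * p x y + c" using c xy(1) by blast
      also have "\<dots> \<le> (e + 1) * N + c" using xy(2) assms(2) by simp
      finally have "e * p (x + u) (y + v) \<le> (e + 1) * N + c" .
      moreover have "(x + u) mod M = r mod M" "(y + v) mod M = s mod M"
        by (simp_all add: u_def v_def mod_simps add.assoc[symmetric])
      ultimately show "z \<in> ?T \<times> ({0..<M} \<times> {0..<M})"
        using W xy(3) assms(1) by (auto simp: \<phi>_def u_def v_def)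
    qed
    moreover have "inj_on \<phi> V"
    proof (rule inj_onI)
      fix z z' assume "\<phi> z = \<phi> z'"
      moreover obtain x y x' y' where "z = (x, y)" "z' = (x', y')" by force
      ultimately have eq: "x mod M = x' mod M" "y mod M = y' mod M"
          "x + (r - x) mod M = x' + (r - x') mod M" "y + (s - y) mod M = y' + (s - y') mod M"
          and z: "z = (x, y)" "z' = (x', y')"
        by (auto simp: \<phi>_def)
      have "(r - x) mod M = (r - x') mod M" "(s - y) mod M = (s - y') mod M"
        using eq(1,2) by (auto intro: mod_diff_cong)
      with eq z show "z = z'" by simp
    qed
    ultimately have "card V \<le> card (?T \<times> ({0..<M} \<times> {0..<M}))"
      using \<open>finite ?T\<close> by (intro card_inj_on_le) auto
    also have "\<dots> = card ?T * (nat M * nat M)" by (simp add: card_cartesian_product)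
    finally have "int (card V) \<le> int (card ?T * (nat M * nat M))" by (rule of_nat_mono)
    with V assms(1) show ?thesis by (simp add: power2_eq_square mult_ac)
  qed
  then show ?thesis by blast
qed

lemma mod_class:
  assumes "x mod M = x' mod M" "y mod M = y' mod M" "odd M"
  shows "p x y mod M = p x' y' mod M"
proof -
  obtain u v where uv: "x = x' + M * u" "y = y' + M * v"
    using assms(1,2) by (metis mod_eqE)
  have "2 * (p x y - p x' y') = M * (2 * G x' y' u v + D * u + E * v + M * Q u v)"
    unfolding right_diff_distrib uv p_shift unfolding G_def Q_def by (simp add: algebra_simps power2_eq_square)
  then have "M dvd 2 * (p x y - p x' y')" by simp
  then have "M dvd p x y - p x' y'" using odd_dvd_double_iff[OF assms(3)] by blast
  then show ?thesis by (simp add: mod_eq_dvd_iff)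
qed

text \<open>If the discriminant is not zero, then modulo a prime \<open>l\<close> not dividing it there is a
  critical point of \<open>p\<close>. All \<open>l\<^sup>2\<close> residue classes modulo \<open>l\<^sup>2\<close> above it carry the same value
  \<open>v\<close> modulo \<open>l\<^sup>2\<close>, and surjectivity of \<open>p\<close> yields one more class with that value. As all classes
  have the same density, the values congruent to \<open>v\<close> are then too frequent.\<close>

lemma disc_zero: "A * C = B\<^sup>2"
proof (rule ccontr)
  assume "A * C \<noteq> B\<^sup>2"
  define \<delta> where "\<delta> = A * C - B\<^sup>2"
  have "\<delta> \<noteq> 0" using \<open>A * C \<noteq> B\<^sup>2\<close> by (simp add: \<delta>_def)
  obtain l' :: nat where l': "prime l'" "l' > nat \<bar>\<delta>\<bar> + 2" using bigger_prime by blast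
  define l where "l = int l'"
  have l: "prime l" "l > \<bar>\<delta>\<bar> + 2" using l' by (auto simp: l_def)
  have "odd l" using l prime_odd_int[of l] by simp
  have "\<not> l dvd \<delta>" using l(2) \<open>\<delta> \<noteq> 0\<close> zdvd_imp_le[of l "\<bar>\<delta>\<bar>"] by auto
  then have ldvd: "l dvd 2 * \<delta> * z \<longleftrightarrow> l dvd z" for z
    using l(1) odd_dvd_double_iff[OF \<open>odd l\<close>] by (simp add: mult.assoc prime_dvd_mult_iff)
  have inverse: "\<exists>k. l dvd z * k - 1" if "\<not> l dvd z" for z
  proof -
    have "coprime z l" using that l(1) prime_imp_coprime coprime_commute by blast
    then obtain k where "[z * k = 1] (mod l)" using cong_solve_coprime_int by blast
    then show ?thesis by (auto simp: cong_iff_dvd_diff)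
  qed
  have "\<not> l dvd 2 * \<delta> * 1" using ldvd[of 1] l by auto
  then obtain \<kappa> where \<kappa>: "l dvd 2 * \<delta> * \<kappa> - 1" using inverse[of "2 * \<delta>"] by auto
  \<comment> \<open>Cramer's rule modulo \<open>l\<close> for the common zero of the partial
    derivatives \<open>g1\<close> and \<open>g2\<close> of \<open>2 * p\<close>;
    \<open>\<kappa>\<close> inverts \<open>2 * \<delta>\<close>.\<close>
  define x0 where "x0 = (\<kappa> * (B * E - C * D)) mod l"
  define y0 where "y0 = (\<kappa> * (B * D - A * E)) mod l"
  have xy0: "0 \<le> x0" "x0 < l" "0 \<le> y0" "y0 < l" using l by (auto simp: x0_def y0_def)
  define g1 where "g1 x y = 2 * A * x + 2 * B * y + D" for x y
  define g2 where "g2 x y = 2 * B * x + 2 * C * y + E" for x y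
  have grad: "2 * p (x + l * u) (y + l * v) = 2 * p x y + l * (g1 x y * u + g2 x y * v) + l\<^sup>2 * Q u v" for x y u v
    unfolding p_shift G_def Q_def g1_def g2_def by (simp add: algebra_simps power2_eq_square)
  have crit: "l dvd g1 x0 y0" "l dvd g2 x0 y0"
  proof -
    obtain a b where ab: "x0 = \<kappa> * (B * E - C * D) - l * a" "y0 = \<kappa> * (B * D - A * E) - l * b"
      unfolding x0_def y0_def by (metis minus_mult_div_eq_mod)
    have "g1 x0 y0 = - (2 * \<delta> * \<kappa> - 1) * D - l * (2 * A * a + 2 * B * b)"
      unfolding g1_def ab \<delta>_def by (simp add: algebra_simps power2_eq_square)
    then have "g1 x0 y0 = (2 * \<delta> * \<kappa> - 1) * (- D) - l * (2 * A * a + 2 * B * b)" by (simp add: algebra_simps)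
    then show "l dvd g1 x0 y0" using dvd_mult2[OF \<kappa>] by (simp only: dvd_diff dvd_triv_left)
    have "g2 x0 y0 = - (2 * \<delta> * \<kappa> - 1) * E - l * (2 * B * a + 2 * C * b)"
      unfolding g2_def ab \<delta>_def by (simp add: algebra_simps power2_eq_square)
    then have "g2 x0 y0 = (2 * \<delta> * \<kappa> - 1) * (- E) - l * (2 * B * a + 2 * C * b)" by (simp add: algebra_simps)
    then show "l dvd g2 x0 y0" using dvd_mult2[OF \<kappa>] by (simp only: dvd_diff dvd_triv_left)
  qed
  have crit_unique: "x mod l = x0 \<and> y mod l = y0" if "l dvd g1 x y" "l dvd g2 x y" for x y
  proof -
    have "2 * \<delta> * (x - x0) = C * (g1 x y - g1 x0 y0) - B * (g2 x y - g2 x0 y0)"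
      "2 * \<delta> * (y - y0) = A * (g2 x y - g2 x0 y0) - B * (g1 x y - g1 x0 y0)"
      unfolding g1_def g2_def \<delta>_def by (simp_all add: algebra_simps power2_eq_square)
    then have "l dvd 2 * \<delta> * (x - x0)" "l dvd 2 * \<delta> * (y - y0)"
      using that crit by simp_all
    then have "x mod l = x0 mod l" "y mod l = y0 mod l"
      unfolding ldvd by (simp_all add: mod_eq_dvd_iff)
    then show ?thesis using xy0 by simp
  qed
  define M where "M = l\<^sup>2"
  have M: "M > 0" "odd M" using l \<open>odd l\<close> by (auto simp: M_def)
  define v where "v = p x0 y0 mod M"
  have dvd_half: "M dvd z" if "M dvd 2 * z" for z
    using that odd_dvd_double_iff[OF M(2)] by blast
  have centre: "p (x0 + l * s) (y0 + l * t) mod M = v" for s t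
  proof -
    obtain h1 h2 where h: "g1 x0 y0 = l * h1" "g2 x0 y0 = l * h2" using crit by (auto elim!: dvdE)
    have "2 * (p (x0 + l * s) (y0 + l * t) - p x0 y0) = M * (h1 * s + h2 * t + Q s t)"
      unfolding right_diff_distrib grad h M_def by (simp add: algebra_simps power2_eq_square)
    then have "M dvd p (x0 + l * s) (y0 + l * t) - p x0 y0" by (metis dvd_half dvd_triv_left)
    then show ?thesis by (simp add: v_def mod_eq_dvd_iff)
  qed
  \<comment> \<open>A value congruent to the central one modulo \<open>l\<close> but not modulo
    \<open>M\<close> cannot come from the critical class, so some partial derivative is a unit at
    \<open>(x1, y1)\<close>. A translation by multiples of \<open>l\<close> then lowers the value by
    \<open>l\<close> modulo \<open>M\<close>; the 2 in \<open>uw\<close> reflects that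
    \<open>p\<close> is doubled.\<close>
  obtain x1 y1 where xy1: "(x1, y1) \<in> W" "p x1 y1 = (p x0 y0 + l) mod M"
    using p_surj[of "(p x0 y0 + l) mod M"] M by auto
  have "\<not> (x1 mod l = x0 \<and> y1 mod l = y0)"
  proof
    assume "x1 mod l = x0 \<and> y1 mod l = y0"
    then have "x1 = x0 + l * (x1 div l)" "y1 = y0 + l * (y1 div l)" by auto
    then have "p x1 y1 mod M = v" using centre by metis
    then have "(p x0 y0 + l) mod M = p x0 y0 mod M" using xy1(2) by (simp add: v_def)
    then have "M dvd l" by (simp add: mod_eq_dvd_iff)
    then have "l * l dvd l * 1" by (simp add: M_def power2_eq_square)
    then show False using l by (subst (asm) dvd_mult_cancel_left) auto
  qed
  then have "\<not> l dvd g1 x1 y1 \<or> \<not> l dvd g2 x1 y1" using crit_unique by blast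
  then obtain u w where uw: "l dvd g1 x1 y1 * u + g2 x1 y1 * w + 2"
  proof
    assume "\<not> l dvd g1 x1 y1"
    then obtain k where "l dvd g1 x1 y1 * k - 1" using inverse by blast
    then have "l dvd - 2 * (g1 x1 y1 * k - 1)" by (rule dvd_mult)
    then show thesis using that[of "- 2 * k" 0] by (simp add: algebra_simps)
  next
    assume "\<not> l dvd g2 x1 y1"
    then obtain k where "l dvd g2 x1 y1 * k - 1" using inverse by blast
    then have "l dvd - 2 * (g2 x1 y1 * k - 1)" by (rule dvd_mult)
    then show thesis using that[of 0 "- 2 * k"] by (simp add: algebra_simps)
  qed
  define x2 where "x2 = (x1 + l * u) mod M"
  define y2 where "y2 = (y1 + l * w) mod M"
  have not_centre: "\<not> (x2 mod l = x0 \<and> y2 mod l = y0)"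
  proof -
    have "x2 mod l = x1 mod l" "y2 mod l = y1 mod l"
      by (simp_all add: x2_def y2_def M_def power2_eq_square mod_mod_cancel)
    then show ?thesis using \<open>\<not> (x1 mod l = x0 \<and> y1 mod l = y0)\<close> by simp
  qed
  have p2: "p x2 y2 mod M = v"
  proof -
    obtain k where k: "g1 x1 y1 * u + g2 x1 y1 * w = l * k - 2"
      using uw by (metis add_diff_cancel_right' dvdE)
    obtain k' where k': "p x1 y1 = p x0 y0 + l + M * k'"
      using xy1(2) by (metis mod_eqE mod_mod_trivial)
    have "2 * (p (x1 + l * u) (y1 + l * w) - p x0 y0) = M * (2 * k' + k + Q u w)"
      unfolding right_diff_distrib grad k k' by (simp add: M_def algebra_simps power2_eq_square)
    then have "M dvd p (x1 + l * u) (y1 + l * w) - p x0 y0" by (metis dvd_half dvd_triv_left)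
    moreover have "p x2 y2 mod M = p (x1 + l * u) (y1 + l * w) mod M"
      using M(2) by (intro mod_class) (simp_all add: x2_def y2_def)
    ultimately show ?thesis unfolding v_def by (metis mod_eq_dvd_iff)
  qed
  define R where "R = insert (x2, y2) ((\<lambda>(s, t). (x0 + l * s, y0 + l * t)) ` ({0..<l} \<times> {0..<l}))"
  have R_range: "0 \<le> x \<and> x < M \<and> 0 \<le> y \<and> y < M" if "(x, y) \<in> R" for x y
  proof -
    have "0 \<le> a + l * s \<and> a + l * s < M" if "0 \<le> a" "a < l" "0 \<le> s" "s < l" for a s
    proof -
      have "l * s \<le> l * (l - 1)" using that by (intro mult_left_mono) auto
      then show ?thesis using that by (simp add: M_def power2_eq_square algebra_simps add_nonneg_nonneg)
    qed
    then show ?thesis using that xy0 M(1) by (auto simp: R_def x2_def y2_def)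
  qed
  have R_val: "p x y mod M = v" if "(x, y) \<in> R" for x y
    using that centre p2 by (auto simp: R_def)
  have R_card: "int (card R) = M + 1"
  proof -
    have "(x2, y2) \<notin> (\<lambda>(s, t). (x0 + l * s, y0 + l * t)) ` ({0..<l} \<times> {0..<l})"
      using not_centre xy0 by auto
    moreover have "inj_on (\<lambda>(s, t). (x0 + l * s, y0 + l * t)) ({0..<l} \<times> {0..<l})"
      using l by (auto simp: inj_on_def)
    ultimately show ?thesis
      using l by (simp add: R_def card_image card_cartesian_product M_def power2_eq_square)
  qed
  have finR: "finite R" by (simp add: R_def)
  \<comment> \<open>The \<open>M + 1\<close> classes of density \<open>1 / M\<^sup>2\<close> exceed
    the density \<open>1 / M\<close> of the values congruent to \<open>v\<close> by the factor
    \<open>1 + 1 / M\<close>. The distortion \<open>1 + 1 / e\<close> has to stay below it.\<close>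
  define e where "e = 2 * M"
  have "e > 0" using M by (simp add: e_def)
  define T where "T r s N c = {(x, y) \<in> W. x mod M = r mod M \<and> y mod M = s mod M \<and> e * p x y \<le> (e + 1) * N + c}"
    for r s N c
  obtain c0 where c0: "\<And>r s N. N \<ge> 0 \<Longrightarrow> N + 1 \<le> M\<^sup>2 * int (card (T r s N (c0 r s)))"
  proof -
    have "\<exists>c. \<forall>N\<ge>0. N + 1 \<le> M\<^sup>2 * int (card (T r s N c))" for r s
      unfolding T_def by (rule class_density[OF M(1) \<open>e > 0\<close>])
    then have "\<exists>c. \<forall>r s. \<forall>N\<ge>0. N + 1 \<le> M\<^sup>2 * int (card (T r s N (c r s)))" by metis
    then show thesis using that by blast
  qed
  define c where "c = (\<Sum>(r, s)\<in>R. \<bar>c0 r s\<bar>)"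
  have c: "c0 r s \<le> c" if "(r, s) \<in> R" for r s
    using member_le_sum[of "(r, s)" R "\<lambda>(r, s). \<bar>c0 r s\<bar>"] that finR by (auto simp: c_def)
  have "c \<ge> 0" by (auto simp: c_def intro: sum_nonneg)
  have "N * M \<le> M * c + e * M\<^sup>2" if N: "N \<ge> 0" for N
  proof -
    define V where "V = ((e + 1) * N + c) div e"
    have "V \<ge> 0" using N \<open>e > 0\<close> \<open>c \<ge> 0\<close> by (simp add: V_def pos_imp_zdiv_nonneg_iff)
    have T_le: "p x y \<in> {k \<in> {0..V}. k mod M = v}" if "(x, y) \<in> T r s N (c0 r s)" "(r, s) \<in> R" for x y r s
    proof -
      have "e * p x y \<le> (e + 1) * N + c" using that c[OF that(2)] by (simp add: T_def)
      then have "p x y \<le> V" using le_div_add_iff[OF \<open>e > 0\<close>, of "p x y" "(e + 1) * N + c" 0] by (simp add: V_def)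
      moreover have "p x y mod M = p r s mod M" using that M by (intro mod_class) (auto simp: T_def)
      ultimately show ?thesis using R_val[OF that(2)] that(1) p_nonneg by (auto simp: T_def)
    qed
    let ?S = "SIGMA z:R. T (fst z) (snd z) N (c0 (fst z) (snd z))"
    have T_fin: "finite (T r s N (c0 r s))" if "(r, s) \<in> R" for r s
    proof (rule finite_imageD)
      have "(\<lambda>(x, y). p x y) ` T r s N (c0 r s) \<subseteq> {0..V}"
        using T_le that by fastforce
      then show "finite ((\<lambda>(x, y). p x y) ` T r s N (c0 r s))" by (rule finite_subset) simp
      show "inj_on (\<lambda>(x, y). p x y) (T r s N (c0 r s))"
        using bij_betw_imp_inj_on[OF bij] by (rule inj_on_subset) (auto simp: T_def)
    qed
    have "inj_on (\<lambda>(z, (x, y)). p x y) ?S"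
    proof (rule inj_onI)
      fix z z' assume z: "z \<in> ?S" "z' \<in> ?S" "(case z of (z, x, y) \<Rightarrow> p x y) = (case z' of (z, x, y) \<Rightarrow> p x y)"
      obtain r s x y r' s' x' y' where zz: "z = ((r, s), (x, y))" "z' = ((r', s'), (x', y'))"
        by (metis surj_pair)
      have xy: "x = x'" "y = y'" using z p_inj[of x y x' y'] by (auto simp: zz T_def)
      moreover have "r mod M = r' mod M" "s mod M = s' mod M" using z xy by (auto simp: zz T_def)
      then have "r = r'" "s = s'" using z R_range[of r s] R_range[of r' s'] by (auto simp: zz)
      ultimately show "z = z'" by (simp add: zz)
    qed
    moreover have "finite {k \<in> {0..V}. k mod M = v}" by (rule finite_subset[of _ "{0..V}"]) auto
    ultimately have "card ?S \<le> card {k \<in> {0..V}. k mod M = v}"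
      using T_le by (intro card_inj_on_le) auto
    then have "int (card ?S) \<le> V div M + 1"
      using card_residue_class_le[OF M(1) \<open>V \<ge> 0\<close>, of v] by simp
    moreover have "(M + 1) * (N + 1) \<le> M\<^sup>2 * int (card ?S)"
    proof -
      have "(\<Sum>z\<in>R. N + 1) \<le> (\<Sum>z\<in>R. M\<^sup>2 * int (card (T (fst z) (snd z) N (c0 (fst z) (snd z)))))"
        using c0[OF N] by (intro sum_mono) auto
      also have "\<dots> = M\<^sup>2 * int (card ?S)"
        using finR T_fin by (subst card_SigmaI) (auto simp: sum_distrib_left)
      finally show ?thesis using R_card by simp
    qed
    ultimately have "(M + 1) * (N + 1) \<le> M\<^sup>2 * (V div M + 1)"
      by (meson mult_left_mono order_trans zero_le_power2)
    also have "\<dots> = M * (M * (V div M)) + M\<^sup>2" by (simp add: algebra_simps power2_eq_square)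
    also have "\<dots> \<le> M * V + M\<^sup>2"
      using M le_div_add_iff[of M "V div M" V 0] by simp
    finally have "e * ((M + 1) * (N + 1)) \<le> e * (M * V + M\<^sup>2)" using \<open>e > 0\<close> by simp
    also have "\<dots> = M * (e * V) + e * M\<^sup>2" by (simp add: algebra_simps)
    also have "e * V \<le> (e + 1) * N + c"
      using le_div_add_iff[OF \<open>e > 0\<close>, of V "(e + 1) * N + c" 0] by (simp add: V_def)
    then have "M * (e * V) \<le> M * ((e + 1) * N + c)" using M by simp
    finally have "e * ((M + 1) * (N + 1)) \<le> M * ((e + 1) * N + c) + e * M\<^sup>2" by simp
    then have "N * M + 2 * M\<^sup>2 + 2 * M \<le> M * c + e * M\<^sup>2"
      unfolding e_def by (simp add: algebra_simps power2_eq_square)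
    moreover have "M\<^sup>2 \<ge> 0" by simp
    ultimately show ?thesis using M by linarith
  qed
  from this[of "c + e * M + 1"] show False
    using \<open>c \<ge> 0\<close> \<open>e > 0\<close> M by (simp add: algebra_simps power2_eq_square)
qed

end

section \<open>Unimodular coordinates and the normal form\<close>

text \<open>With \<open>g = gcd A B\<close>, \<open>A = g * s\<close> and \<open>B = g * t\<close>,
  coprimality turns \<open>s * C = g * t\<^sup>2\<close> into \<open>s dvd g\<close>, and the
  quotient is \<open>a\<close>.\<close>

lemma square_disc_factorization:
  fixes A B C :: int
  assumes "A > 0" "A * C = B\<^sup>2"
  obtains a s t where "a > 0" "s > 0" "coprime s t" "A = a * s\<^sup>2" "B = a * s * t" "C = a * t\<^sup>2"
proof -
  define g where "g = gcd A B"
  define s where "s = A div g"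
  define t where "t = B div g"
  have g: "g > 0" using assms by (simp add: g_def)
  have AB: "A = g * s" "B = g * t" by (simp_all add: g_def s_def t_def)
  have cop: "coprime s t"
    using assms(1) by (simp add: s_def t_def g_def div_gcd_coprime)
  have s: "s > 0" using assms(1) g AB(1) by (simp add: zero_less_mult_iff)
  have "g * (s * C) = g * (g * t\<^sup>2)"
    using assms(2) unfolding AB by (simp add: power2_eq_square mult_ac)
  then have sC: "s * C = g * t\<^sup>2" using g by simp
  then have "s dvd g * t\<^sup>2" by (metis dvd_triv_left)
  then have "s dvd g" using cop by (simp add: coprime_dvd_mult_left_iff)
  then obtain a where a: "g = s * a" by blast
  then have "C = a * t\<^sup>2" using sC s by simp
  then show ?thesis
    using that[of a s t] a AB cop s g by (simp add: power2_eq_square mult_ac zero_less_mult_iff)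
qed

text \<open>Two reduced fractions \<open>c / q\<close> and \<open>c' / q'\<close> whose difference
  is an integer have the same denominator.\<close>

lemma slopes_eq:
  fixes c q c' q' a :: int
  assumes "q > 0" "q' > 0" "coprime c q" "coprime c' q'" "c' * q - c * q' = a * (q * q')"
  shows "q' = q \<and> c' = c + a * q"
proof -
  have "c' * q = q' * (c + a * q)" "c * q' = q * (c' - a * q')" using assms(5) by (simp_all add: algebra_simps)
  then have "q' dvd c' * q" "q dvd c * q'" by (metis dvd_triv_left)+
  then have "q' dvd q" "q dvd q'"
    using assms by (simp_all add: coprime_commute coprime_dvd_mult_right_iff)
  then have "q' = q" using assms by (simp add: zdvd_antisym_nonneg)
  with \<open>c' * q = q' * (c + a * q)\<close> assms show ?thesis by (simp add: mult.commute)
qed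

definition lin :: "int \<Rightarrow> int \<Rightarrow> int \<Rightarrow> int \<Rightarrow> int \<times> int \<Rightarrow> int \<times> int" where
  "lin \<alpha> \<beta> \<gamma> \<delta> = (\<lambda>(x, y). (\<alpha> * x + \<beta> * y, \<gamma> * x + \<delta> * y))"

text \<open>The determinant \<open>\<sigma>\<close> is 1 or -1, so \<open>\<sigma>\<close> times the
  adjugate is an integral inverse.\<close>

lemma bij_betw_lin:
  assumes "\<sigma> = \<alpha> * \<delta> - \<beta> * \<gamma>" "\<sigma> * \<sigma> = 1" "\<And>z. lin \<alpha> \<beta> \<gamma> \<delta> z \<in> S' \<longleftrightarrow> z \<in> S"
  shows "bij_betw (lin \<alpha> \<beta> \<gamma> \<delta>) S S'"
proof (rule bij_betw_byWitness[where f' = "lin (\<sigma> * \<delta>) (- \<sigma> * \<beta>) (- \<sigma> * \<gamma>) (\<sigma> * \<alpha>)"])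
  have right: "lin \<alpha> \<beta> \<gamma> \<delta> (lin (\<sigma> * \<delta>) (- \<sigma> * \<beta>) (- \<sigma> * \<gamma>) (\<sigma> * \<alpha>) (j, i)) = (j, i)" for j i
  proof -
    have "\<alpha> * (\<sigma> * \<delta> * j + - \<sigma> * \<beta> * i) + \<beta> * (- \<sigma> * \<gamma> * j + \<sigma> * \<alpha> * i) = \<sigma> * (\<alpha> * \<delta> - \<beta> * \<gamma>) * j"
      "\<gamma> * (\<sigma> * \<delta> * j + - \<sigma> * \<beta> * i) + \<delta> * (- \<sigma> * \<gamma> * j + \<sigma> * \<alpha> * i) = \<sigma> * (\<alpha> * \<delta> - \<beta> * \<gamma>) * i"
      by (simp_all add: algebra_simps)
    then show ?thesis unfolding lin_def assms(1)[symmetric] assms(2) by simp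
  qed
  then have right: "lin \<alpha> \<beta> \<gamma> \<delta> (lin (\<sigma> * \<delta>) (- \<sigma> * \<beta>) (- \<sigma> * \<gamma>) (\<sigma> * \<alpha>) z) = z" for z
    by (cases z) blast
  then show "\<forall>z\<in>S'. lin \<alpha> \<beta> \<gamma> \<delta> (lin (\<sigma> * \<delta>) (- \<sigma> * \<beta>) (- \<sigma> * \<gamma>) (\<sigma> * \<alpha>) z) = z"
    by blast
  show "lin (\<sigma> * \<delta>) (- \<sigma> * \<beta>) (- \<sigma> * \<gamma>) (\<sigma> * \<alpha>) ` S' \<subseteq> S"
  proof
    fix z assume "z \<in> lin (\<sigma> * \<delta>) (- \<sigma> * \<beta>) (- \<sigma> * \<gamma>) (\<sigma> * \<alpha>) ` S'"
    then have "lin \<alpha> \<beta> \<gamma> \<delta> z \<in> S'" using right by force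
    then show "z \<in> S" by (simp add: assms(3))
  qed
  have "lin (\<sigma> * \<delta>) (- \<sigma> * \<beta>) (- \<sigma> * \<gamma>) (\<sigma> * \<alpha>) (lin \<alpha> \<beta> \<gamma> \<delta> (x, y)) = (x, y)" for x y
  proof -
    have "\<sigma> * \<delta> * (\<alpha> * x + \<beta> * y) + - \<sigma> * \<beta> * (\<gamma> * x + \<delta> * y) = \<sigma> * (\<alpha> * \<delta> - \<beta> * \<gamma>) * x"
      "- \<sigma> * \<gamma> * (\<alpha> * x + \<beta> * y) + \<sigma> * \<alpha> * (\<gamma> * x + \<delta> * y) = \<sigma> * (\<alpha> * \<delta> - \<beta> * \<gamma>) * y"
      by (simp_all add: algebra_simps)
    then show ?thesis unfolding lin_def assms(1)[symmetric] assms(2) by simp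
  qed
  then show "\<forall>z\<in>S. lin (\<sigma> * \<delta>) (- \<sigma> * \<beta>) (- \<sigma> * \<gamma>) (\<sigma> * \<alpha>) (lin \<alpha> \<beta> \<gamma> \<delta> z) = z"
    by auto
qed (use assms(3) in auto)

lemma lin_lin:
  "lin a1 b1 c1 d1 (lin a2 b2 c2 d2 z) =
     lin (a1 * a2 + b1 * c2) (a1 * b2 + b1 * d2) (c1 * a2 + d1 * c2) (c1 * b2 + d1 * d2) z"
  by (cases z) (simp add: lin_def algebra_simps)

text \<open>In the coordinates \<open>x = d i - h j\<close>, \<open>y = q i - c j\<close> the wedge, and also the polynomial, no longer
  depends on \<open>c\<close> and \<open>h\<close>.\<close>

lemma bij_betw_normal_wedge:
  assumes "c * d = 1 + q * h"
  shows "bij_betw (lin (- h) d (- c) q) (wedge c q (c + a * q) q) (wedge 0 1 (a * q\<^sup>2) (1 + a * q * d))"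
proof (rule bij_betw_lin[where \<sigma> = 1])
  show "1 = - h * q - d * - c" using assms by (simp add: algebra_simps)
  have cd1: "c * d - q * h = 1" using assms by simp
  have "(1 + a * q * d) * (- c * j + q * i) - a * q\<^sup>2 * (- h * j + d * i)
      = q * i - c * j - a * q * (c * d - q * h) * j" for i j
    by (simp add: algebra_simps power2_eq_square)
  then have "(1 + a * q * d) * (- c * j + q * i) - a * q\<^sup>2 * (- h * j + d * i) = q * i - (c + a * q) * j" for i j
    unfolding cd1 by (simp add: distrib_right)
  then have "(1 + a * q * d) * (- c * j + q * i) \<le> a * q\<^sup>2 * (- h * j + d * i) \<longleftrightarrow> q * i \<le> (c + a * q) * j" for i j
    by (metis diff_le_0_iff_le)
  then show "lin (- h) d (- c) q z \<in> wedge 0 1 (a * q\<^sup>2) (1 + a * q * d) \<longleftrightarrow> z \<in> wedge c q (c + a * q) q" for z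
    by (cases z) (auto simp: wedge_def lin_def)
qed simp

context packing
begin

text \<open>The sign \<open>\<sigma>\<close> orients the level lines in such a way that \<open>p\<close> increases along them.\<close>

lemma level_coordinates:
  assumes "coprime n m"
  obtains a b d s t u w \<sigma> where
    "a > 0" "d > 0" "s > 0" "\<sigma> = s * w - t * u" "\<sigma> * \<sigma> = 1"
    "A = a * s\<^sup>2" "B = a * s * t" "C = a * t\<^sup>2" "D = b * s + 2 * d * u" "E = b * t + 2 * d * w"
    "s * m + t * n > 0"
proof -
  have A: "A > 0" using Q_pos[of 1 0] nm by (simp add: W_iff Q_def)
  obtain a s t where ast: "a > 0" "s > 0" "coprime s t" "A = a * s\<^sup>2" "B = a * s * t" "C = a * t\<^sup>2"
    using square_disc_factorization[OF A disc_zero] by blast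
  have Q_eq: "Q x y = a * (s * x + t * y)\<^sup>2" for x y
    unfolding Q_def unfolding ast by (simp add: algebra_simps power2_eq_square)
  define r where "r = s * m + t * n"
  \<comment> \<open>The form \<open>s * x + t * y\<close> is positive at \<open>(1, 0)\<close>. If
    it were not at \<open>(m, n)\<close>, it would vanish at a nonzero lattice point of the wedge,
    against \<open>Q_pos\<close>.\<close>
  have "r > 0"
  proof (rule ccontr)
    assume "\<not> r > 0"
    then have "- r * n \<ge> 0" using nm by (simp add: mult_nonpos_nonneg)
    then have "(- r + s * m, s * n) \<in> W" using nm ast by (simp add: W_iff algebra_simps)
    moreover have "s * n \<noteq> 0" using nm ast by simp
    ultimately have "Q (- r + s * m) (s * n) > 0" using Q_pos by simp
    moreover have "s * (- r + s * m) + t * (s * n) = 0" by (simp add: r_def algebra_simps)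
    ultimately show False by (simp add: Q_eq)
  qed
  obtain w0 u1 where "w0 * s + u1 * t = 1" using ast(3) bezout_int[of s t] by auto
  define u0 where "u0 = - u1"
  have det0: "s * w0 - t * u0 = 1" using \<open>w0 * s + u1 * t = 1\<close> by (simp add: u0_def algebra_simps)
  define d0 where "d0 = p (- t) s - F"
  define b where "b = D * w0 - E * u0"
  have "2 * p (- t) s = - D * t + E * s + 2 * F"
    unfolding p ast by (simp add: algebra_simps power2_eq_square)
  then have d0: "2 * d0 = s * E - t * D" by (simp add: d0_def algebra_simps)
  have DE: "D = b * s + 2 * d0 * u0" "E = b * t + 2 * d0 * w0"
  proof -
    have "b * s + 2 * d0 * u0 = D * (s * w0 - t * u0)" "b * t + 2 * d0 * w0 = E * (s * w0 - t * u0)"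
      unfolding b_def d0 by (simp_all add: algebra_simps)
    then show "D = b * s + 2 * d0 * u0" "E = b * t + 2 * d0 * w0" using det0 by simp_all
  qed
  have p_eq: "2 * p x y = a * (s * x + t * y)\<^sup>2 + b * (s * x + t * y) + 2 * d0 * (u0 * x + w0 * y) + 2 * F" for x y
    unfolding p ast DE by (simp add: algebra_simps power2_eq_square)
  \<comment> \<open>With \<open>d0 = 0\<close> the value would depend on the level alone, but
    \<open>(r, 0)\<close> and \<open>(s * m, s * n)\<close> lie on the same level.\<close>
  have "d0 \<noteq> 0"
  proof
    assume "d0 = 0"
    moreover have "s * r + t * 0 = s * (s * m) + t * (s * n)" by (simp add: r_def algebra_simps)
    ultimately have "2 * p r 0 = 2 * p (s * m) (s * n)" unfolding p_eq by (simp only: mult_zero_left mult_zero_right)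
    then have "p r 0 = p (s * m) (s * n)" by simp
    moreover have "(r, 0) \<in> W" "(s * m, s * n) \<in> W" using \<open>r > 0\<close> nm ast by (auto simp: W_iff mult_ac)
    ultimately have "0 = s * n" using p_inj by blast
    with nm ast show False by simp
  qed
  define \<sigma> where "\<sigma> = sgn d0"
  have \<sigma>: "\<sigma> * \<sigma> = 1" using \<open>d0 \<noteq> 0\<close> by (simp add: \<sigma>_def sgn_if)
  have ds: "\<bar>d0\<bar> * \<sigma> = d0" by (simp add: \<sigma>_def abs_mult_sgn)
  have "\<sigma> * (s * w0 - t * u0) = \<sigma>" by (simp only: det0 mult_1_right)
  then have "\<sigma> = s * (\<sigma> * w0) - t * (\<sigma> * u0)" by (simp add: algebra_simps)
  moreover have ds': "2 * \<bar>d0\<bar> * (\<sigma> * v) = 2 * d0 * v" for v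
  proof -
    have "2 * \<bar>d0\<bar> * (\<sigma> * v) = 2 * (\<bar>d0\<bar> * \<sigma>) * v" by (simp only: mult_ac)
    then show ?thesis unfolding ds .
  qed
  have "D = b * s + 2 * \<bar>d0\<bar> * (\<sigma> * u0)" "E = b * t + 2 * \<bar>d0\<bar> * (\<sigma> * w0)"
    unfolding ds' by (rule DE)+
  moreover have "\<bar>d0\<bar> > 0" using \<open>d0 \<noteq> 0\<close> by simp
  ultimately show ?thesis
    using that[OF ast(1) _ ast(2) _ \<sigma> ast(4-6)] \<open>r > 0\<close> unfolding r_def by blast
qed

text \<open>In level coordinates, \<open>wedge_slopes\<close> and \<open>slopes_eq\<close> give both
  boundary slopes the denominator \<open>q\<close>; then \<open>chain_relation\<close> and
  \<open>good\<close> restrict the remaining parameters. Composing with the coordinates of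
  \<open>bij_betw_normal_wedge\<close> removes \<open>c\<close> and \<open>h\<close>.\<close>

lemma normal_form:
  assumes "coprime n m"
  obtains a d q x1 x2 y1 y2 where
    "a > 0" "d > 0" "q > 0" "coprime q d" "good_start a d F"
    "bij_betw (lin x1 x2 y1 y2) W (wedge 0 1 (a * q\<^sup>2) (1 + a * q * d))"
    "A = a * (q * x1 - d * y1)\<^sup>2" "B = a * (q * x1 - d * y1) * (q * x2 - d * y2)"
    "C = a * (q * x2 - d * y2)\<^sup>2"
    "D = 2 * x1 - a * d * (q * x1 - d * y1)" "E = 2 * x2 - a * d * (q * x2 - d * y2)"
proof -
  obtain a b d s t u w \<sigma> where
    pos: "a > 0" "d > 0" "s > 0" and \<sigma>: "\<sigma> = s * w - t * u" "\<sigma> * \<sigma> = 1"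
    and ABC: "A = a * s\<^sup>2" "B = a * s * t" "C = a * t\<^sup>2"
    and DE: "D = b * s + 2 * d * u" "E = b * t + 2 * d * w" and r: "s * m + t * n > 0"
    by (rule level_coordinates[OF assms])
  define r where "r = s * m + t * n"
  define k where "k = u * m + w * n"
  have "\<sigma> = 1 \<or> \<sigma> = - 1" using \<sigma>(2) by (simp add: square_eq_1_iff)
  have cop: "coprime u s" "coprime k r"
  proof -
    show "coprime u s"
    proof (rule coprimeI)
      fix x assume "x dvd u" "x dvd s"
      then have "x dvd \<sigma> * \<sigma>" unfolding \<sigma>(1) by simp
      then show "is_unit x" using \<sigma>(2) by simp
    qed
    show "coprime k r"
    proof (rule coprimeI)
      fix x assume x: "x dvd k" "x dvd r"
      have "\<sigma> * (s * k - u * r) = (\<sigma> * \<sigma>) * n" "\<sigma> * (w * r - t * k) = (\<sigma> * \<sigma>) * m"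
        unfolding mult.assoc unfolding \<sigma>(1) k_def r_def by (simp_all add: algebra_simps)
      then have "x dvd n" "x dvd m" using x \<sigma>(2) by (metis dvd_diff dvd_mult mult_1)+
      then show "is_unit x" using assms coprime_common_divisor by blast
    qed
  qed
  define P where "P j i = (case lin (\<sigma> * w) (- \<sigma> * t) (- \<sigma> * u) (\<sigma> * s) (j, i) of (x, y) \<Rightarrow> p x y)" for j i
  have inv: "lin (\<sigma> * w) (- \<sigma> * t) (- \<sigma> * u) (\<sigma> * s) (lin s t u w z) = z" for z
  proof (cases z)
    case (Pair x y)
    have "\<sigma> * w * (s * x + t * y) + - \<sigma> * t * (u * x + w * y) = \<sigma> * (s * w - t * u) * x"
      "- \<sigma> * u * (s * x + t * y) + \<sigma> * s * (u * x + w * y) = \<sigma> * (s * w - t * u) * y"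
      by (simp_all add: algebra_simps)
    then show ?thesis unfolding Pair lin_def \<sigma>(1)[symmetric] \<sigma>(2) by simp
  qed
  have inv': "lin s t u w (lin (\<sigma> * w) (- \<sigma> * t) (- \<sigma> * u) (\<sigma> * s) (j, i)) = (j, i)" for j i
  proof -
    have "s * (\<sigma> * w * j + - \<sigma> * t * i) + t * (- \<sigma> * u * j + \<sigma> * s * i) = \<sigma> * (s * w - t * u) * j"
      "u * (\<sigma> * w * j + - \<sigma> * t * i) + w * (- \<sigma> * u * j + \<sigma> * s * i) = \<sigma> * (s * w - t * u) * i"
      by (simp_all add: algebra_simps)
    then show ?thesis unfolding lin_def \<sigma>(1)[symmetric] \<sigma>(2) by simp
  qed
  have P: "2 * P j i = a * j\<^sup>2 + b * j + 2 * d * i + 2 * F" for j i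
  proof -
    obtain x y where xy: "lin (\<sigma> * w) (- \<sigma> * t) (- \<sigma> * u) (\<sigma> * s) (j, i) = (x, y)" by force
    then have "lin s t u w (x, y) = (j, i)" using inv'[of j i] by simp
    then have ji: "j = s * x + t * y" "i = u * x + w * y" by (simp_all add: lin_def)
    have "2 * P j i = 2 * p x y" unfolding P_def xy by simp
    then show ?thesis unfolding p ABC DE ji by (simp add: algebra_simps power2_eq_square)
  qed
  \<comment> \<open>The boundary vectors \<open>(1, 0)\<close> and \<open>(m, n)\<close> go to
    \<open>(s, u)\<close> and \<open>(r, k)\<close>. For \<open>\<sigma> = - 1\<close> the map
    reverses orientation, which exchanges the lower and the upper boundary.\<close>
  define c where "c = (if \<sigma> = 1 then u else k)"
  define c' where "c' = (if \<sigma> = 1 then k else u)"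
  define q where "q = (if \<sigma> = 1 then s else r)"
  define q' where "q' = (if \<sigma> = 1 then r else s)"
  have image: "bij_betw (lin s t u w) W (wedge c q c' q')"
  proof (rule bij_betw_lin[OF \<sigma>])
    fix z :: "int \<times> int"
    obtain x y where z: "z = (x, y)" by force
    have "s * (u * x + w * y) - u * (s * x + t * y) = \<sigma> * y"
      "k * (s * x + t * y) - r * (u * x + w * y) = \<sigma> * (n * x - m * y)"
      unfolding \<sigma>(1) k_def r_def by (simp_all add: algebra_simps)
    then have "u * (s * x + t * y) \<le> s * (u * x + w * y) \<longleftrightarrow> 0 \<le> \<sigma> * y"
      "s * (u * x + w * y) \<le> u * (s * x + t * y) \<longleftrightarrow> \<sigma> * y \<le> 0"
      "r * (u * x + w * y) \<le> k * (s * x + t * y) \<longleftrightarrow> 0 \<le> \<sigma> * (n * x - m * y)"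
      "k * (s * x + t * y) \<le> r * (u * x + w * y) \<longleftrightarrow> \<sigma> * (n * x - m * y) \<le> 0"
      by linarith+
    then show "lin s t u w z \<in> wedge c q c' q' \<longleftrightarrow> z \<in> W"
      using \<open>\<sigma> = 1 \<or> \<sigma> = - 1\<close> unfolding z by (auto simp: lin_def wedge_def c_def c'_def q_def q'_def)
  qed
  have "(\<lambda>(j, i). P j i) (lin s t u w z) = (\<lambda>(x, y). p x y) z" for z
  proof -
    obtain j i where ji: "lin s t u w z = (j, i)" by force
    then have "lin (\<sigma> * w) (- \<sigma> * t) (- \<sigma> * u) (\<sigma> * s) (j, i) = z" using inv[of z] by simp
    then have "P j i = (\<lambda>(x, y). p x y) z" unfolding P_def by (rule arg_cong)
    then show ?thesis unfolding ji by simp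
  qed
  then have "(\<lambda>(j, i). P j i) \<circ> lin s t u w = (\<lambda>(x, y). p x y)" by (simp add: fun_eq_iff)
  then have P_bij: "bij_betw (\<lambda>(j, i). P j i) (wedge c q c' q') {0..}"
    using bij bij_betw_comp_iff[OF image, of "\<lambda>(j, i). P j i"] by simp
  have qpos: "q > 0" "q' > 0" using pos r by (auto simp: q_def q'_def r_def)
  have "s * k - u * r = \<sigma> * n" unfolding \<sigma>(1) k_def r_def by (simp add: algebra_simps)
  then have "c' * q - c * q' = n"
    using \<open>\<sigma> = 1 \<or> \<sigma> = - 1\<close> by (auto simp: c_def c'_def q_def q'_def mult.commute)
  then have "c' * q - c * q' = a * (q * q')"
    using wedge_slopes[OF pos(1,2) qpos _ P P_bij] nm by simp
  moreover have cop': "coprime c q" "coprime c' q'" using cop by (auto simp: c_def c'_def q_def q'_def)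
  ultimately have eq: "q' = q" "c' = c + a * q"
    using slopes_eq[OF qpos] by blast+
  have P_bij': "bij_betw (\<lambda>(j, i). P j i) (wedge c q (c + a * q) q) {0..}"
    using P_bij by (simp add: eq)
  interpret L: bij_levels a b d q c F P
    by unfold_locales (use pos qpos P P_bij' in auto)
  obtain h where h: "c * d = 1 + q * h" "b = - (a * d + 2 * h)"
    using L.chain_relation cop' by blast
  interpret K: bij_chain a d q c h F P
    by unfold_locales (use pos qpos h P P_bij' in \<open>auto simp: h(2)\<close>)
  have "bij_betw (lin (- h) d (- c) q \<circ> lin s t u w) W (wedge 0 1 (a * q\<^sup>2) (1 + a * q * d))"
    using image bij_betw_normal_wedge[OF h(1), of a] unfolding eq by (rule bij_betw_trans)
  then have bij': "bij_betw (lin (- h * s + d * u) (- h * t + d * w) (- c * s + q * u) (- c * t + q * w)) W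
      (wedge 0 1 (a * q\<^sup>2) (1 + a * q * d))"
    by (simp add: comp_def lin_lin)
  have "q * (- h * s + d * u) - d * (- c * s + q * u) = (c * d - q * h) * s"
    "q * (- h * t + d * w) - d * (- c * t + q * w) = (c * d - q * h) * t"
    by (simp_all add: algebra_simps)
  then have st: "q * (- h * s + d * u) - d * (- c * s + q * u) = s"
    "q * (- h * t + d * w) - d * (- c * t + q * w) = t"
    using h(1) by simp_all
  have "coprime q d"
  proof (rule coprimeI)
    fix x assume "x dvd q" "x dvd d"
    then have "x dvd c * d - q * h" by simp
    with h(1) show "is_unit x" by simp
  qed
  show ?thesis
  proof (rule that[OF pos(1,2) qpos(1) \<open>coprime q d\<close> K.good bij'], unfold st)
    show "D = 2 * (- h * s + d * u) - a * d * s" "E = 2 * (- h * t + d * w) - a * d * t"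
      using DE h(2) by (simp_all add: algebra_simps)
  qed (rule ABC)+
qed

end

section \<open>Polynomials and sectors\<close>

definition quad2 :: "real \<Rightarrow> real \<Rightarrow> real \<Rightarrow> real \<Rightarrow> real \<Rightarrow> real \<Rightarrow> poly2" where
  "quad2 A B C D E F = [:[:F, D, A:], [:E, B:], [:C:]:]"

lemma eval2_quad2:
  "eval2 (quad2 A B C D E F) (x, y) = A * x\<^sup>2 + B * x * y + C * y\<^sup>2 + D * x + E * y + F"
  by (simp add: eval2_def quad2_def algebra_simps power2_eq_square)

lemma coeff_quad2_eq_0:
  assumes "i + j > 2" shows "coeff (coeff (quad2 A B C D E F) j) i = 0"
proof -
  consider "j = 0" "i \<ge> 3" | "j = 1" "i \<ge> 2" | "j = 2" "i \<ge> 1" | "j \<ge> 3"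
    using assms by linarith
  then show ?thesis
    by cases (auto simp: quad2_def coeff_pCons split: nat.split)
qed

lemma total_degree2_quad2:
  assumes "A \<noteq> 0 \<or> B \<noteq> 0 \<or> C \<noteq> 0"
  shows "total_degree2 (quad2 A B C D E F) = 2"
proof -
  let ?S = "{i + j |i j. coeff (coeff (quad2 A B C D E F) j) i \<noteq> 0}"
  have le: "k \<le> 2" if "k \<in> ?S" for k
  proof -
    from that obtain i j where "k = i + j" "coeff (coeff (quad2 A B C D E F) j) i \<noteq> 0" by blast
    then show ?thesis using coeff_quad2_eq_0[of i j A B C D E F] by linarith
  qed
  have coeffs: "coeff (coeff (quad2 A B C D E F) 0) 2 = A" "coeff (coeff (quad2 A B C D E F) 1) 1 = B"
    "coeff (coeff (quad2 A B C D E F) 2) 0 = C"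
    by (simp_all add: quad2_def numeral_2_eq_2)
  have mem: "i + j \<in> ?S" if "coeff (coeff (quad2 A B C D E F) j) i \<noteq> 0" for i j
    using that by blast
  have "2 \<in> ?S"
    using assms mem[of 0 2, unfolded coeffs] mem[of 1 1, unfolded coeffs] mem[of 2 0, unfolded coeffs]
    by (elim disjE) (simp_all only: simp_thms add_0 add_0_right one_add_one)
  moreover have "finite ?S" using le by (intro finite_subset[of ?S "{..2}"]) auto
  ultimately show ?thesis
    unfolding total_degree2_def using le by (intro Max_eqI) auto
qed

lemma total_degree2_eq_2E:
  assumes "total_degree2 p = 2"
  obtains A B C D E F where "p = quad2 A B C D E F" "A \<noteq> 0 \<or> B \<noteq> 0 \<or> C \<noteq> 0"
proof -
  let ?S = "{i + j |i j. coeff (coeff p j) i \<noteq> 0}"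
  have "?S \<subseteq> (\<lambda>(j, i). i + j) ` (SIGMA j:{..degree p}. {..degree (coeff p j)})"
  proof clarify
    fix i j assume ij: "coeff (coeff p j) i \<noteq> 0"
    then have "i \<le> degree (coeff p j)" "coeff p j \<noteq> 0" by (auto intro: le_degree)
    then have "(j, i) \<in> (SIGMA j:{..degree p}. {..degree (coeff p j)})" by (auto intro: le_degree)
    then show "i + j \<in> (\<lambda>(j, i). i + j) ` (SIGMA j:{..degree p}. {..degree (coeff p j)})" by force
  qed
  then have fin: "finite ?S" by (rule finite_subset) auto
  then have le: "i + j \<le> 2" if "coeff (coeff p j) i \<noteq> 0" for i j
    using that assms unfolding total_degree2_def by (metis (mono_tags, lifting) Max_ge finite_insert insertCI mem_Collect_eq)
  have "Max (insert 0 ?S) \<in> insert 0 ?S" using fin by (intro Max_in) auto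
  then have "2 \<in> ?S" using assms unfolding total_degree2_def by auto
  then obtain i j where ij: "i + j = 2" "coeff (coeff p j) i \<noteq> 0" by auto
  then consider "i = 2" "j = 0" | "i = 1" "j = 1" | "i = 0" "j = 2" by linarith
  then have nz: "coeff (coeff p 0) 2 \<noteq> 0 \<or> coeff (coeff p 1) 1 \<noteq> 0 \<or> coeff (coeff p 2) 0 \<noteq> 0"
    using ij by cases auto
  have zero: "coeff (coeff p j) i = 0" if "i + j > 2" for i j
    using le that by (meson not_le)
  have "p = quad2 (coeff (coeff p 0) 2) (coeff (coeff p 1) 1) (coeff (coeff p 2) 0)
    (coeff (coeff p 0) 1) (coeff (coeff p 1) 0) (coeff (coeff p 0) 0)"
    unfolding quad2_def
    by (intro poly_eqI) (auto simp: coeff_pCons zero eval_nat_numeral split: nat.splits)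
  then show ?thesis using nz that by blast
qed

lemma f_poly_eq: "f_poly n = quad2 (real n / 2) 0 0 (1 - real n / 2) 1 0"
  and g_poly_eq: "g_poly n = quad2 (real n / 2) 0 0 (1 + real n / 2) (- 1) 0"
  and exc3_poly_eq: "exc3_poly = quad2 (3 / 2) 0 0 (- 7 / 2) 3 2"
  and exc4_poly_eq: "exc4_poly = quad2 2 0 0 (- 3) 2 1"
  by (simp_all add: f_poly_def g_poly_def exc3_poly_def exc4_poly_def quad2_def const2_def varX_def varY_def
      power2_eq_square one_pCons)

lemma p_poly_eq:
  assumes "n > 0"
  shows "p_poly n m k f = quad2 (real n / 2) (- (real m - 1)) ((real m - 1)\<^sup>2 / (2 * real n))
    (1 - real k * real (gcd n (m - 1)) / 2)
    ((2 * (1 - real m) + real k * real (gcd n (m - 1)) * (real m + 1)) / (2 * real n)) f"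
  using assms
  by (simp add: p_poly_def Let_def quad2_def const2_def varX_def varY_def power2_eq_square field_simps)

section \<open>Lattice points of sectors and transport of packing polynomials\<close>

definition emb :: "int \<times> int \<Rightarrow> real \<times> real" where
  "emb z = (of_int (fst z), of_int (snd z))"

lemma sector_lattice_eq:
  assumes "n > 0" "m > 0"
  shows "sector_lattice (real_of_int n / real_of_int m) = emb ` wedge 0 1 n m"
proof (intro equalityI subsetI)
  fix z assume z: "z \<in> sector_lattice (real_of_int n / real_of_int m)"
  then obtain x y where xy: "z = (real_of_int x, real_of_int y)"
    by (auto simp: sector_lattice_def elim!: Ints_cases)
  have "0 \<le> y" "real_of_int m * real_of_int y \<le> real_of_int n * real_of_int x"
    using z assms by (auto simp: sector_lattice_def sector_def xy field_simps)
  moreover from this(2) have "m * y \<le> n * x" by (metis of_int_le_iff of_int_mult)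
  ultimately have "(x, y) \<in> wedge 0 1 n m" "z = emb (x, y)" by (auto simp: wedge_def emb_def xy)
  then show "z \<in> emb ` wedge 0 1 n m" by blast
next
  fix z assume "z \<in> emb ` wedge 0 1 n m"
  then obtain x y where xy: "z = (real_of_int x, real_of_int y)" "0 \<le> y" "m * y \<le> n * x"
    by (auto simp: emb_def wedge_def)
  have "0 \<le> m * y" using xy(2) assms by simp
  also note xy(3)
  finally have "0 \<le> x" using assms by (simp add: zero_le_mult_iff)
  moreover have "real_of_int m * real_of_int y \<le> real_of_int n * real_of_int x"
    using xy(3) by (metis of_int_le_iff of_int_mult)
  ultimately show "z \<in> sector_lattice (real_of_int n / real_of_int m)"
    using xy assms by (auto simp: sector_lattice_def sector_def field_simps)
qed

lemma bij_betw_emb: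
  assumes "n > 0" "m > 0"
  shows "bij_betw emb (wedge 0 1 n m) (sector_lattice (real_of_int n / real_of_int m))"
  unfolding sector_lattice_eq[OF assms] by (intro bij_betw_imageI) (auto simp: inj_on_def emb_def)

lemma packing_polynomial_iff:
  assumes "n > 0" "m > 0" and P: "\<And>x y. eval2 p (real_of_int x, real_of_int y) = real_of_int (P x y)"
  shows "packing_polynomial (real_of_int n / real_of_int m) p \<longleftrightarrow>
    bij_betw (\<lambda>(x, y). P x y) (wedge 0 1 n m) {0..}"
proof -
  have nat: "bij_betw real_of_int {0..} \<nat>"
    by (auto simp: bij_betw_def inj_on_def Nats_altdef1)
  have "eval2 p \<circ> emb = real_of_int \<circ> (\<lambda>(x, y). P x y)"
    by (auto simp: emb_def P)
  then show ?thesis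
    unfolding packing_polynomial_def bij_betw_comp_iff[OF bij_betw_emb[OF assms(1,2)]]
    using bij_betw_comp_iff2[OF nat, of "\<lambda>(x, y). P x y" "wedge 0 1 n m"]
  proof -
    assume "eval2 p \<circ> emb = real_of_int \<circ> (\<lambda>(x, y). P x y)"
      and eq: "(\<lambda>(x, y). P x y) ` wedge 0 1 n m \<subseteq> {0..} \<Longrightarrow>
        bij_betw (\<lambda>(x, y). P x y) (wedge 0 1 n m) {0..} =
        bij_betw (real_of_int \<circ> (\<lambda>(x, y). P x y)) (wedge 0 1 n m) \<nat>"
    moreover have "(\<lambda>(x, y). P x y) ` wedge 0 1 n m \<subseteq> {0..}"
      if "bij_betw (real_of_int \<circ> (\<lambda>(x, y). P x y)) (wedge 0 1 n m) \<nat>"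
      using bij_betw_imp_surj_on[OF that] by (force simp: Nats_altdef1)
    ultimately show "bij_betw (eval2 p \<circ> emb) (wedge 0 1 n m) \<nat> = bij_betw (\<lambda>(x, y). P x y) (wedge 0 1 n m) {0..}"
      by (metis bij_betw_imp_surj_on equalityD1)
  qed
qed

lemma packing_equivalent_transfer:
  assumes nm: "n > 0" "m > 0" "n' > 0" "m' > 0"
    and bij: "bij_betw (lin \<alpha> \<beta> \<gamma> \<delta>) (wedge 0 1 n m) (wedge 0 1 n' m')"
    and eval: "\<And>x y. eval2 p (x, y) =
      eval2 p' (real_of_int \<alpha> * x + real_of_int \<beta> * y, real_of_int \<gamma> * x + real_of_int \<delta> * y)"
    and pack: "packing_polynomial (real_of_int n / real_of_int m) p
      \<or> packing_polynomial (real_of_int n' / real_of_int m') p'"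
  shows "packing_equivalent (real_of_int n / real_of_int m) p (real_of_int n' / real_of_int m') p'"
proof -
  let ?S = "sector_lattice (real_of_int n / real_of_int m)"
  let ?S' = "sector_lattice (real_of_int n' / real_of_int m')"
  define T :: "real \<times> real \<Rightarrow> real \<times> real" where
    "T = (\<lambda>z. (of_int \<alpha> * fst z + of_int \<beta> * snd z, of_int \<gamma> * fst z + of_int \<delta> * snd z))"
  have "linear T"
    unfolding T_def by (intro linearI) (auto simp: algebra_simps)
  moreover have "T \<circ> emb = emb \<circ> lin \<alpha> \<beta> \<gamma> \<delta>"
    by (auto simp: T_def emb_def lin_def)
  then have bijT: "bij_betw T ?S ?S'"
    using bij_betw_trans[OF bij bij_betw_emb[OF nm(3,4)]] bij_betw_comp_iff[OF bij_betw_emb[OF nm(1,2)], of T]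
    by simp
  moreover have evalT: "eval2 p = eval2 p' \<circ> T"
    using eval by (auto simp: T_def fun_eq_iff)
  moreover have "packing_polynomial (real_of_int n / real_of_int m) p
      \<longleftrightarrow> packing_polynomial (real_of_int n' / real_of_int m') p'"
    unfolding packing_polynomial_def evalT using bij_betw_comp_iff[OF bijT] by blast
  ultimately show ?thesis using pack unfolding packing_equivalent_def by blast
qed

lemma packing_equivalent_trans:
  assumes "packing_equivalent \<alpha> p \<beta> q" "packing_equivalent \<beta> q \<gamma> r"
  shows "packing_equivalent \<alpha> p \<gamma> r"
proof -
  obtain T U where "linear T" "bij_betw T (sector_lattice \<alpha>) (sector_lattice \<beta>)" "eval2 p = eval2 q \<circ> T"
    "linear U" "bij_betw U (sector_lattice \<beta>) (sector_lattice \<gamma>)" "eval2 q = eval2 r \<circ> U"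
    using assms unfolding packing_equivalent_def by blast
  then have "linear (U \<circ> T)" "bij_betw (U \<circ> T) (sector_lattice \<alpha>) (sector_lattice \<gamma>)" "eval2 p = eval2 r \<circ> (U \<circ> T)"
    by (auto intro: linear_compose bij_betw_trans simp: comp_assoc)
  then show ?thesis using assms unfolding packing_equivalent_def by blast
qed

text \<open>This is \<open>a j\<^sup>2 / 2 - a d j / 2 + x + f\<close> for \<open>j = q x - d y\<close>.\<close>

definition normal_poly :: "int \<Rightarrow> int \<Rightarrow> int \<Rightarrow> int \<Rightarrow> poly2" where
  "normal_poly a d q f = quad2 (of_int a * (of_int q)\<^sup>2 / 2) (- (of_int a * of_int q * of_int d))
     (of_int a * (of_int d)\<^sup>2 / 2) (1 - of_int a * of_int d * of_int q / 2) (of_int a * (of_int d)\<^sup>2 / 2) (of_int f)"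

lemma eval2_normal_poly:
  "eval2 (normal_poly a d q f) (x, y) = of_int a / 2 * (of_int q * x - of_int d * y)\<^sup>2
     - of_int a * of_int d / 2 * (of_int q * x - of_int d * y) + x + of_int f"
  by (simp add: normal_poly_def eval2_quad2 field_simps power2_eq_square)

text \<open>Coprimality of \<open>q\<close> and \<open>d\<close> is the solvability of
  \<open>c * d = 1 + q * h\<close>.\<close>

definition normal_data :: "int \<Rightarrow> int \<Rightarrow> int \<Rightarrow> int \<Rightarrow> bool" where
  "normal_data a d q f \<longleftrightarrow> a > 0 \<and> d > 0 \<and> q > 0 \<and> coprime q d \<and> good_start a d f"

lemma packing_normal_poly:
  assumes "normal_data a d q f"
  shows "packing_polynomial (of_int (a * q\<^sup>2) / of_int (1 + a * q * d)) (normal_poly a d q f)"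
proof -
  have pos: "a > 0" "d > 0" "q > 0" and "coprime q d" and good: "good_start a d f"
    using assms by (auto simp: normal_data_def)
  then obtain h' c where "h' * q + c * d = 1" using bezout_int[of q d] by auto
  define h where "h = - h'"
  have cd: "c * d = 1 + q * h" using \<open>h' * q + c * d = 1\<close> by (simp add: h_def algebra_simps)
  have even: "even (a * j\<^sup>2 - a * d * j)" for j
    using good by (auto simp: good_start_def)
  define N where "N x y = (a * (q * x - d * y)\<^sup>2 - a * d * (q * x - d * y)) div 2 + x + f" for x y
  have N: "2 * N x y = a * (q * x - d * y)\<^sup>2 - a * d * (q * x - d * y) + 2 * x + 2 * f" for x y
    using even[of "q * x - d * y"] by (simp add: N_def)
  define P where "P j i = N (- h * j + d * i) (- c * j + q * i)" for j i
  have "2 * P j i = a * j\<^sup>2 + - (a * d + 2 * h) * j + 2 * d * i + 2 * f" for j i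
  proof -
    have "q * (- h * j + d * i) - d * (- c * j + q * i) = (c * d - q * h) * j" by (simp add: algebra_simps)
    then have "q * (- h * j + d * i) - d * (- c * j + q * i) = j" using cd by simp
    then show ?thesis unfolding P_def N by (simp add: algebra_simps)
  qed
  then interpret chain a d q c h f P
    by unfold_locales (use pos cd in auto)
  have "(\<lambda>(x, y). N x y) \<circ> lin (- h) d (- c) q = (\<lambda>(j, i). P j i)"
    by (auto simp: P_def lin_def)
  then have "bij_betw (\<lambda>(x, y). N x y) (wedge 0 1 (a * q\<^sup>2) (1 + a * q * d)) {0..}"
    using P_bij_good[OF good] bij_betw_comp_iff[OF bij_betw_normal_wedge[OF cd], of "\<lambda>(x, y). N x y" a] by simp
  moreover have "eval2 (normal_poly a d q f) (of_int x, of_int y) = of_int (N x y)" for x y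
  proof -
    have "2 * eval2 (normal_poly a d q f) (of_int x, of_int y) = real_of_int (2 * N x y)"
      unfolding N eval2_normal_poly by (simp add: field_simps)
    then show ?thesis by simp
  qed
  moreover have "a * q\<^sup>2 > 0" "1 + a * q * d > 0" using pos by (simp_all add: add_pos_pos)
  ultimately show ?thesis by (subst packing_polynomial_iff) auto
qed

section \<open>Shears from the normal sectors to those of the theorem\<close>

text \<open>The shear \<open>(x, y) \<mapsto> (x + \<tau> * y, y)\<close> keeps the numerator
  \<open>n\<close> of the slope and changes the denominator by \<open>\<tau> * n\<close>.\<close>

lemma normal_poly_sheared:
  assumes data: "normal_data a d q f" and n: "n = a * q\<^sup>2" and m: "m = 1 + a * q * d + \<tau> * n" "m > 0"
    and eval: "\<And>x y. eval2 p (x, y) = eval2 (normal_poly a d q f) (x - of_int \<tau> * y, y)"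
  shows "packing_equivalent (of_int (a * q\<^sup>2) / of_int (1 + a * q * d)) (normal_poly a d q f) (of_int n / of_int m) p"
proof -
  have pos: "a > 0" "d > 0" "q > 0" using data by (auto simp: normal_data_def)
  have "bij_betw (lin 1 \<tau> 0 1) (wedge 0 1 n (1 + a * q * d)) (wedge 0 1 n m)"
    by (rule bij_betw_lin[where \<sigma> = 1]) (auto simp: lin_def wedge_def m algebra_simps)
  then show ?thesis
    using pos m(2) packing_normal_poly[OF data] unfolding n
    by (intro packing_equivalent_transfer) (auto simp: eval add_pos_pos)
qed

text \<open>Since \<open>n = a * q\<^sup>2\<close> and \<open>m - 1 = a * q * e\<close> with
  \<open>e = \<tau> * q + d\<close> prime to \<open>q\<close>, the number
  \<open>gcd n (m - 1)\<close> is \<open>a * q\<close>. With this value \<open>p_poly\<close> is the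
  sheared normal polynomial.\<close>

lemma p_poly_sheared:
  assumes data: "normal_data a d q f" and n: "int n = a * q\<^sup>2"
    and m: "int m = 1 + a * q * d + \<tau> * int n" "m > 0" and k: "int k = d"
  shows "packing_equivalent (of_int (a * q\<^sup>2) / of_int (1 + a * q * d)) (normal_poly a d q f)
    (real n / real m) (p_poly n m k (of_int f))"
proof -
  have pos: "a > 0" "d > 0" "q > 0" and cop: "coprime q d" using data by (auto simp: normal_data_def)
  define e where "e = \<tau> * q + d"
  have m1: "int (m - 1) = (a * q) * e"
    using m n by (simp add: e_def of_nat_diff algebra_simps power2_eq_square)
  have "coprime q e" using cop by (simp add: e_def coprime_iff_gcd_eq_1 gcd_add_mult)
  then have "gcd (int n) (int (m - 1)) = a * q"
    unfolding n m1 using pos by (simp add: power2_eq_square mult.assoc gcd_mult_left coprime_iff_gcd_eq_1 abs_mult)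
  then have "int (gcd n (m - 1)) = a * q" by simp
  then have l: "real (gcd n (m - 1)) = of_int a * of_int q" by (metis of_int_mult of_int_of_nat_eq)
  have nR: "real n = of_int a * (of_int q)\<^sup>2" using n by (metis of_int_mult of_int_of_nat_eq of_int_power)
  have mR: "real m = 1 + of_int a * of_int q * of_int e"
  proof -
    have "int m = 1 + a * q * e" using m1 m(2) by simp
    then have "real_of_int (int m) = real_of_int (1 + a * q * e)" by simp
    then show ?thesis by simp
  qed
  have kR: "real k = of_int d" using k by (metis of_int_of_nat_eq)
  have "n > 0" using n pos by (metis of_nat_0_less_iff zero_less_mult_iff zero_less_power)
  have eR: "real_of_int e = of_int d + of_int \<tau> * of_int q" by (simp add: e_def)
  have "eval2 (p_poly n m k (of_int f)) (x, y) = eval2 (normal_poly a d q f) (x - of_int \<tau> * y, y)" for x y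
    unfolding p_poly_eq[OF \<open>n > 0\<close>] eval2_quad2 eval2_normal_poly l nR mR kR eR
    using pos by (simp add: field_simps power2_eq_square)
  then show ?thesis
    using normal_poly_sheared[OF data n m(1), of "p_poly n m k (of_int f)"] m(2) by simp
qed

text \<open>For \<open>q = 1\<close> the shear with \<open>\<tau> = - d\<close> turns the
  denominator \<open>1 + a * d\<close> into 1 and the linear form of the normal polynomial into
  \<open>x\<close>.\<close>

lemma integer_sector_sheared:
  assumes data: "normal_data a d 1 f"
    and eval: "\<And>x y. eval2 p (x, y) = of_int a / 2 * x\<^sup>2 + (1 - of_int a * of_int d / 2) * x + of_int d * y + of_int f"
  shows "packing_equivalent (of_int (a * 1\<^sup>2) / of_int (1 + a * 1 * d)) (normal_poly a d 1 f) (of_int a) p"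
proof -
  have "eval2 p (x, y) = eval2 (normal_poly a d 1 f) (x - of_int (- d) * y, y)" for x y
    unfolding eval eval2_normal_poly by (simp add: field_simps power2_eq_square)
  then show ?thesis
    using normal_poly_sheared[OF data, of a 1 "- d" p] by simp
qed

text \<open>The parameters of an admissible triple: \<open>n = a q\<^sup>2\<close>, \<open>k = d\<close> and \<open>m = 1 + a q d\<close>, except for
  \<open>n / m = 12 / 7\<close>, where \<open>m\<close> is reduced modulo \<open>n\<close>.\<close>

lemma admissible_normal_data:
  assumes "admissible n m k"
  obtains a q f \<tau> where "normal_data a (int k) q f" "int n = a * q\<^sup>2"
    "int m = 1 + a * q * int k + \<tau> * int n"
proof -
  have pos: "n > 0" "m > 0" "m \<noteq> 1" and cop: "coprime n m"
    using assms by (auto simp: admissible_def coprime_iff_gcd_eq_1)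
  consider
    (1) "k = 1" "n dvd (m - 1)\<^sup>2" "(m - 1) dvd n"
  | (2) "k = 2" "[m = 9] (mod 16)" "real n = 1 / 16 * (real m - 1)\<^sup>2"
  | (3) "k = 3" "[m = 10] (mod 27) \<or> [m = 19] (mod 27)" "real n = 1 / 27 * (real m - 1)\<^sup>2"
  | (4) "k = 3" "real n / real m = 12 / 7"
    using assms unfolding admissible_def by blast
  then show ?thesis
  proof cases
    case 1
    then obtain q where q: "n = (m - 1) * q" by blast
    then have "(m - 1) * q dvd (m - 1) * (m - 1)" using 1(2) by (simp add: power2_eq_square)
    then have "q dvd m - 1" using pos by (auto simp: nat_mult_dvd_cancel_disj)
    then obtain a where a: "m - 1 = q * a" by blast
    have "a > 0" "q > 0" using a pos by (auto intro!: Nat.gr0I)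
    moreover have "int n = int a * (int q)\<^sup>2" using q a by (simp add: power2_eq_square)
    moreover have "m = 1 + q * a" using a pos by simp
    then have "int m = 1 + int a * int q" by simp
    ultimately show ?thesis
      using 1 that[of "int a" "int q" 0 0] by (simp add: normal_data_def good_start_def)
  next
    case 2
    have "m mod 16 = 9" using 2(2) by (simp add: cong_def)
    define q where "q = 2 * (m div 16) + 1"
    have m: "m = 1 + 8 * q" using \<open>m mod 16 = 9\<close> div_mult_mod_eq[of m 16] by (simp add: q_def)
    then have "real n = real (4 * q\<^sup>2)" using 2(3) by (simp add: power2_eq_square)
    then have "n = 4 * q\<^sup>2" using of_nat_eq_iff by blast
    moreover have "odd q" "q > 0" by (simp_all add: q_def)
    ultimately show ?thesis
      using 2 m that[of 4 "int q" 1 0] by (simp add: normal_data_def good_start_def)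
  next
    case 3
    have "m mod 27 = 10 \<or> m mod 27 = 19" using 3(2) by (simp add: cong_def)
    then obtain q where m: "m = 1 + 9 * q" and q: "q mod 3 = 1 \<or> q mod 3 = 2"
    proof
      assume *: "m mod 27 = 10"
      have "m = 1 + 9 * (3 * (m div 27) + 1)" using * div_mult_mod_eq[of m 27] by simp
      moreover have "(3 * (m div 27) + 1) mod 3 = 1" by presburger
      ultimately show thesis using that by blast
    next
      assume *: "m mod 27 = 19"
      have "m = 1 + 9 * (3 * (m div 27) + 2)" using * div_mult_mod_eq[of m 27] by simp
      moreover have "(3 * (m div 27) + 2) mod 3 = 2" by presburger
      ultimately show thesis using that by blast
    qed
    then have "real n = real (3 * q\<^sup>2)" using 3(3) by (simp add: power2_eq_square)
    then have "n = 3 * q\<^sup>2" using of_nat_eq_iff by blast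
    moreover have "\<not> 3 dvd int q" "q > 0" using q by presburger+
    then have "coprime (int q) 3" using prime_imp_coprime[of "3::int" "int q"] by (simp add: coprime_commute)
    ultimately show ?thesis
      using 3 m \<open>q > 0\<close> that[of 3 "int q" 2 0] by (simp add: normal_data_def good_start_def)
  next
    case 4
    then have "real (7 * n) = real (12 * m)" using pos by (simp add: field_simps)
    then have eq: "7 * n = 12 * m" using of_nat_eq_iff by blast
    then have "n dvd 12 * m" "m dvd 7 * n" by (metis dvd_triv_right)+
    then have "n dvd 12" "m dvd 7"
      using cop by (simp_all add: coprime_dvd_mult_left_iff coprime_commute)
    then have "n \<le> 12" "m \<le> 7" by (auto intro: dvd_imp_le)
    then have "n = 12" "m = 7" using eq pos by presburger+
    \<comment> \<open>\<open>12 = 3 * 2\<^sup>2\<close>, and one shear reduces the denominator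
      \<open>1 + 3 * 2 * 3 = 19\<close> to 7.\<close>
    then show ?thesis
      using 4 that[of 3 2 2 "- 1"] by (simp add: normal_data_def good_start_def)
  qed
qed

text \<open>For these data \<open>1 + a * q * d\<close> is below \<open>a * q\<^sup>2\<close> except
  when \<open>d = 3\<close>, \<open>a = 3\<close> and \<open>q = 2\<close>, where the slope 12/19 is
  sheared to 12/7.\<close>

lemma normal_data_admissible:
  assumes "normal_data a d q f" "q > 1"
  obtains n m k \<tau> where "admissible n m k" "int n = a * q\<^sup>2" "int m = 1 + a * q * d + \<tau> * int n" "int k = d"
proof -
  have pos: "a > 0" "d > 0" and cop: "coprime q d" and good: "good_start a d f"
    using assms by (auto simp: normal_data_def)
  define a' where "a' = nat a"
  define q' where "q' = nat q"
  have aq: "a = int a'" "q = int q'" "a' > 0" "q' > 1" using pos assms(2) by (auto simp: a'_def q'_def)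
  have gcd1: "gcd n m = 1" if "int n = a * q\<^sup>2" "int m = 1 + a * q * d" for n m
  proof -
    have "coprime (int n) (int m)"
    proof (rule coprimeI)
      fix x assume x: "x dvd int n" "x dvd int m"
      have "int m * (1 - a * q * d) + int n * (a * d\<^sup>2) = 1"
        unfolding that by (simp add: algebra_simps power2_eq_square)
      then show "is_unit x" using x by (metis dvd_add dvd_mult2)
    qed
    then show ?thesis by (simp add: coprime_iff_gcd_eq_1)
  qed
  have cop': "coprime q' (nat d)" using cop pos by (simp add: aq coprime_int_iff[symmetric])
  consider "d = 1" | "d = 2" "a = 4" | "d = 3" "a = 3" "q = 2" | "d = 3" "a = 3" "q \<noteq> 2"
    using good by (auto simp: good_start_def)
  then show ?thesis
  proof cases
    case 1
    define n where "n = a' * q'\<^sup>2"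
    define m where "m = 1 + a' * q'"
    have nm: "int n = a * q\<^sup>2" "int m = 1 + a * q * d" by (simp_all add: n_def m_def aq 1)
    have "a' * q' * 2 \<le> n" using aq by (simp add: n_def power2_eq_square)
    moreover have "2 \<le> a' * q'" using aq mult_le_mono[of 1 a' 2 q'] by simp
    ultimately have "m < n" by (simp add: m_def)
    moreover have "m > 0" by (simp add: m_def)
    ultimately have "real n / real m > 1" by simp
    moreover have "n dvd (m - 1)\<^sup>2" "m - 1 dvd n" by (simp_all add: n_def m_def power2_eq_square)
    ultimately have "admissible n m 1"
      using gcd1[OF nm] aq \<open>m < n\<close> unfolding admissible_def by (auto simp: m_def)
    then show ?thesis using that[of n m 1 0] nm 1 by simp
  next
    case 2
    define n where "n = 4 * q'\<^sup>2"
    define m where "m = 1 + 8 * q'"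
    have nm: "int n = a * q\<^sup>2" "int m = 1 + a * q * d" by (simp_all add: n_def m_def aq(2) 2)
    have "odd q'" using cop' 2 by simp
    then have "q' \<ge> 3" using aq(4) by presburger
    then have "q' * 3 \<le> q' * q'" by simp
    then have "m < n" using \<open>q' \<ge> 3\<close> unfolding m_def n_def power2_eq_square by linarith
    moreover have "m > 0" by (simp add: m_def)
    ultimately have "real n / real m > 1" by simp
    moreover have "[m = 9] (mod 16)" using \<open>odd q'\<close> unfolding m_def cong_def by presburger
    moreover have "real n = 1 / 16 * (real m - 1)\<^sup>2" by (simp add: m_def n_def power2_eq_square)
    ultimately have "admissible n m 2"
      using gcd1[OF nm] aq \<open>m < n\<close> unfolding admissible_def by (auto simp: m_def)
    then show ?thesis using that[of n m 2 0] nm 2 by simp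
  next
    case 3
    have "admissible 12 7 3" by (simp add: admissible_def gcd_non_0_nat)
    then show ?thesis using that[of 12 7 3 "- 1"] 3 by simp
  next
    case 4
    define n where "n = 3 * q'\<^sup>2"
    define m where "m = 1 + 9 * q'"
    have nm: "int n = a * q\<^sup>2" "int m = 1 + a * q * d" by (simp_all add: n_def m_def aq(2) 4)
    have "\<not> 3 dvd q'"
    proof
      assume "3 dvd q'"
      moreover have "coprime q' 3" using cop' 4 by simp
      ultimately show False using coprime_common_divisor[of q' 3 3] by simp
    qed
    then have "q' \<ge> 4" using aq(4) 4(3) aq(2) by presburger
    then have "q' * 4 \<le> q' * q'" by simp
    then have "m < n" using \<open>q' \<ge> 4\<close> unfolding m_def n_def power2_eq_square by linarith
    moreover have "m > 0" by (simp add: m_def)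
    ultimately have "real n / real m > 1" by simp
    moreover have "[m = 10] (mod 27) \<or> [m = 19] (mod 27)" 
    proof -
      have "q' mod 3 = 1 \<or> q' mod 3 = 2" using \<open>\<not> 3 dvd q'\<close> by presburger
      then have "m = 27 * (q' div 3) + 10 \<or> m = 27 * (q' div 3) + 19"
        using div_mult_mod_eq[of q' 3] unfolding m_def by linarith
      then show ?thesis by (auto simp: cong_def)
    qed
    moreover have "real n = 1 / 27 * (real m - 1)\<^sup>2" by (simp add: m_def n_def power2_eq_square)
    ultimately have "admissible n m 3"
      using gcd1[OF nm] aq \<open>m < n\<close> unfolding admissible_def by (auto simp: m_def)
    then show ?thesis using that[of n m 3 0] nm 4 by simp
  qed
qed

section \<open>The listed polynomials are packing polynomials\<close>

lemma f_poly_packing_equivalent: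
  assumes "a > 0"
  shows "packing_equivalent (of_int (a * 1\<^sup>2) / of_int (1 + a * 1 * 1)) (normal_poly a 1 1 0) (of_int a) (f_poly (nat a))"
  using assms by (intro integer_sector_sheared) (auto simp: normal_data_def good_start_def f_poly_eq eval2_quad2)

lemma exc3_poly_packing_equivalent:
  "packing_equivalent (of_int (3 * 1\<^sup>2) / of_int (1 + 3 * 1 * 3)) (normal_poly 3 3 1 2) (of_int 3) exc3_poly"
  by (intro integer_sector_sheared) (auto simp: normal_data_def good_start_def exc3_poly_eq eval2_quad2)

lemma exc4_poly_packing_equivalent:
  "packing_equivalent (of_int (4 * 1\<^sup>2) / of_int (1 + 4 * 1 * 2)) (normal_poly 4 2 1 1) (of_int 4) exc4_poly"
  by (intro integer_sector_sheared) (auto simp: normal_data_def good_start_def exc4_poly_eq eval2_quad2)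

lemma quadratic_packing_f_poly:
  assumes "n \<ge> 1" shows "quadratic_packing_polynomial (real n) (f_poly n)"
proof -
  have "packing_polynomial (real n) (f_poly n)"
    using f_poly_packing_equivalent[of "int n"] assms by (simp add: packing_equivalent_def)
  moreover have "total_degree2 (f_poly n) = 2"
    unfolding f_poly_eq using assms by (intro total_degree2_quad2) auto
  ultimately show ?thesis by (simp add: quadratic_packing_polynomial_def)
qed

text \<open>The reflection \<open>(x, y) \<mapsto> (x, n * x - y)\<close> exchanges the boundary
  rays of the sector and carries \<open>f_poly n\<close> to \<open>g_poly n\<close>.\<close>

lemma quadratic_packing_g_poly:
  assumes "n \<ge> 1" shows "quadratic_packing_polynomial (real n) (g_poly n)"
proof -
  have "bij_betw (lin 1 0 (int n) (- 1)) (wedge 0 1 (int n) 1) (wedge 0 1 (int n) 1)"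
    by (rule bij_betw_lin[where \<sigma> = "- 1"]) (auto simp: lin_def wedge_def)
  then have "packing_equivalent (of_int (int n) / of_int 1) (g_poly n) (of_int (int n) / of_int 1) (f_poly n)"
  proof (rule packing_equivalent_transfer[rotated 4])
    show "packing_polynomial (of_int (int n) / of_int 1) (g_poly n) \<or> packing_polynomial (of_int (int n) / of_int 1) (f_poly n)"
      using quadratic_packing_f_poly[OF assms] by (simp add: quadratic_packing_polynomial_def)
  qed (use assms in \<open>auto simp: f_poly_eq g_poly_eq eval2_quad2 algebra_simps\<close>)
  then have "packing_polynomial (real n) (g_poly n)" by (simp add: packing_equivalent_def)
  moreover have "total_degree2 (g_poly n) = 2"
    unfolding g_poly_eq using assms by (intro total_degree2_quad2) auto
  ultimately show ?thesis by (simp add: quadratic_packing_polynomial_def)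
qed

lemma quadratic_packing_p_poly:
  assumes "admissible n m k"
  shows "\<exists>f. quadratic_packing_polynomial (real n / real m) (p_poly n m k f)"
proof -
  obtain a q f \<tau> where "normal_data a (int k) q f" "int n = a * q\<^sup>2" "int m = 1 + a * q * int k + \<tau> * int n"
    using admissible_normal_data[OF assms] by blast
  moreover have nm: "n > 0" "m > 0" using assms by (auto simp: admissible_def)
  ultimately have "packing_polynomial (real n / real m) (p_poly n m k (of_int f))"
    using p_poly_sheared[of a "int k" q f n m \<tau> k] by (simp add: packing_equivalent_def)
  moreover have "total_degree2 (p_poly n m k (of_int f)) = 2"
    unfolding p_poly_eq[OF nm(1)] using nm by (intro total_degree2_quad2) auto
  ultimately show ?thesis by (auto simp: quadratic_packing_polynomial_def)
qed

section \<open>Reduction of an arbitrary packing polynomial to the list\<close>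

text \<open>Differences of the values at \<open>(0, 0)\<close>, \<open>(1, 0)\<close>,
  \<open>(2, 0)\<close>, \<open>(m, 1)\<close>, \<open>(m + 1, 1)\<close> and
  \<open>(2 * m, 2)\<close>, all in the sector, give the coefficients. The parity conditions say
  that \<open>A + D\<close> and \<open>C + E\<close> are integers, so the polynomial is integral at
  all lattice points, also outside the sector.\<close>

lemma packing_coefficients_integral:
  fixes n m :: int
  assumes nm: "n > 0" "m > 0" and pack: "packing_polynomial (of_int n / of_int m) (quad2 A B C D E F)"
  obtains A' B' C' D' E' F' where "2 * A = of_int A'" "B = of_int B'" "2 * C = of_int C'"
    "2 * D = of_int D'" "2 * E = of_int E'" "F = of_int F'" "even (A' + D')" "even (C' + E')"
proof -
  have val: "eval2 (quad2 A B C D E F) (of_int x, of_int y) \<in> \<int>" if "0 \<le> y" "m * y \<le> n * x" for x y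
  proof -
    have "emb (x, y) \<in> sector_lattice (of_int n / of_int m)"
      unfolding sector_lattice_eq[OF nm] using that by (auto simp: wedge_def)
    then have "eval2 (quad2 A B C D E F) (emb (x, y)) \<in> \<nat>"
      using pack bij_betwE unfolding packing_polynomial_def by blast
    then show ?thesis using Nats_subset_Ints by (auto simp: emb_def)
  qed
  have W: "m * 1 \<le> n * m" "m * 1 \<le> n * (m + 1)" "m * 2 \<le> n * (2 * m)"
    using nm mult_right_mono[of 1 n m] mult_right_mono[of 1 n "m + 1"] by (simp_all add: algebra_simps)
  have v: "F \<in> \<int>" "A + D + F \<in> \<int>" "A * 4 + D * 2 + F \<in> \<int>"
    "A * (of_int m)\<^sup>2 + B * of_int m + C + D * of_int m + E + F \<in> \<int>"
    "A * (of_int m + 1)\<^sup>2 + B * (of_int m + 1) + C + D * (of_int m + 1) + E + F \<in> \<int>"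
    "A * (2 * of_int m)\<^sup>2 + B * (2 * of_int m) * 2 + C * 4 + D * (2 * of_int m) + E * 2 + F \<in> \<int>"
    subgoal using val[of 0 0] by (simp add: eval2_quad2)
    subgoal using val[of 0 1] nm unfolding eval2_quad2 by simp
    subgoal using val[of 0 2] nm unfolding eval2_quad2 by simp
    subgoal using val[of 1 m] W unfolding eval2_quad2 by simp
    subgoal using val[of 1 "m + 1"] W unfolding eval2_quad2 by simp
    subgoal using val[of 2 "2 * m"] W unfolding eval2_quad2 by simp
    done
  obtain F' where F': "F = of_int F'" using v(1) by (elim Ints_cases)
  obtain u where u: "A + D + F = of_int u" using v(2) by (elim Ints_cases)
  obtain w where w: "A * 4 + D * 2 + F = of_int w" using v(3) by (elim Ints_cases)
  obtain r where r: "A * (of_int m)\<^sup>2 + B * of_int m + C + D * of_int m + E + F = of_int r" using v(4) by (elim Ints_cases)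
  obtain s where s: "A * (of_int m + 1)\<^sup>2 + B * (of_int m + 1) + C + D * (of_int m + 1) + E + F = of_int s"
    using v(5) by (elim Ints_cases)
  obtain t where t: "A * (2 * of_int m)\<^sup>2 + B * (2 * of_int m) * 2 + C * 4 + D * (2 * of_int m) + E * 2 + F = of_int t"
    using v(6) by (elim Ints_cases)
  define g where "g = u - F'"
  define A' where "A' = w - F' - 2 * g"
  define B' where "B' = s - r - A' * m - g"
  define M where "M = m * (m - 1) div 2"
  have M: "2 * M = m * (m - 1)" by (simp add: M_def)
  define h where "h = r - A' * M - g * m - B' * m - F'"
  define M2 where "M2 = m * (2 * m - 1)"
  define C' where "C' = t - A' * M2 - g * (2 * m) - 4 * B' * m - F' - 2 * h"
  have g: "A + D = of_int g" using u F' by (simp add: g_def)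
  have A': "2 * A = of_int A'" using w F' g by (simp add: A'_def)
  have D: "D = of_int g - A" using g by simp
  have B': "B = of_int B'"
    using r s unfolding B'_def D of_int_diff of_int_mult A'[symmetric] by (simp add: algebra_simps power2_eq_square flip: r s)
  have "2 * of_int M = of_int m * (of_int m - (1::real))" using M by (metis of_int_diff of_int_1 of_int_mult of_int_numeral)
  then have "A * (2 * of_int M) = A * (of_int m * (of_int m - 1))" by simp
  then have "A * (of_int m)\<^sup>2 - A * of_int m = of_int A' * of_int M"
    unfolding A'[symmetric] by (simp add: algebra_simps power2_eq_square)
  then have h: "C + E = of_int h"
    unfolding h_def of_int_diff of_int_mult B'[symmetric] F'[symmetric] r[symmetric] D by (simp add: algebra_simps)
  have C': "2 * C = of_int C'"
    unfolding C'_def M2_def of_int_diff of_int_mult of_int_numeral of_int_1 B'[symmetric] F'[symmetric] t[symmetric] h[symmetric] A'[symmetric] D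
    by (simp add: algebra_simps power2_eq_square)
  have "2 * D = of_int (2 * g - A')" "2 * E = of_int (2 * h - C')"
    using D A' h C' by simp_all
  then show ?thesis using that[of A' B' C' "2 * g - A'" "2 * h - C'" F'] A' B' C' F' by simp
qed

text \<open>Integrality puts \<open>p\<close> into the setting of \<open>packing\<close>. The
  coefficient equations of \<open>normal_form\<close> then make the identity with the transformed
  normal polynomial hold at all real points.\<close>

lemma packing_equivalent_normal_poly:
  assumes nm: "n > 0" "m > 0" "coprime n m" and pack: "packing_polynomial (of_int n / of_int m) p"
    and deg: "total_degree2 p = 2"
  obtains a d q f where "normal_data a d q f"
    "packing_equivalent (of_int n / of_int m) p (of_int (a * q\<^sup>2) / of_int (1 + a * q * d)) (normal_poly a d q f)"
proof -
  obtain A B C D E F where p: "p = quad2 A B C D E F" by (rule total_degree2_eq_2E[OF deg])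
  obtain A' B' C' D' E' F' where coeffs: "2 * A = of_int A'" "B = of_int B'" "2 * C = of_int C'"
    "2 * D = of_int D'" "2 * E = of_int E'" "F = of_int F'" and even: "even (A' + D')" "even (C' + E')"
    by (rule packing_coefficients_integral[OF nm(1,2) pack[unfolded p]])
  define P where "P x y = (A' * x\<^sup>2 + 2 * B' * x * y + C' * y\<^sup>2 + D' * x + E' * y) div 2 + F'" for x y
  have "even (A' * x\<^sup>2 + D' * x)" "even (C' * y\<^sup>2 + E' * y)" for x y
    using even by auto
  then have "even (A' * x\<^sup>2 + D' * x + (C' * y\<^sup>2 + E' * y) + 2 * (B' * x * y))" for x y
    by (simp only: dvd_add dvd_triv_left)
  moreover have "A' * x\<^sup>2 + D' * x + (C' * y\<^sup>2 + E' * y) + 2 * (B' * x * y)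
      = A' * x\<^sup>2 + 2 * B' * x * y + C' * y\<^sup>2 + D' * x + E' * y" for x y
    by simp
  ultimately have "even (A' * x\<^sup>2 + 2 * B' * x * y + C' * y\<^sup>2 + D' * x + E' * y)" for x y
    by metis
  then have P: "2 * P x y = A' * x\<^sup>2 + 2 * B' * x * y + C' * y\<^sup>2 + D' * x + E' * y + 2 * F'" for x y
    by (simp add: P_def)
  have eval: "2 * eval2 p (x, y) = of_int A' * x\<^sup>2 + 2 * of_int B' * x * y + of_int C' * y\<^sup>2 + of_int D' * x + of_int E' * y + 2 * of_int F'" for x y
    unfolding p eval2_quad2 coeffs[symmetric] by (simp add: algebra_simps)
  have "eval2 p (of_int x, of_int y) = of_int (P x y)" for x y
  proof -
    have "2 * eval2 p (of_int x, of_int y) = of_int (2 * P x y)" unfolding P eval by simp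
    then show ?thesis by simp
  qed
  then have "bij_betw (\<lambda>(x, y). P x y) (wedge 0 1 n m) {0..}"
    using pack packing_polynomial_iff[OF nm(1,2)] by blast
  then interpret L: packing n m A' B' C' D' E' F' P
    by unfold_locales (use nm P in auto)
  obtain a d q x1 x2 y1 y2 where pos: "a > 0" "d > 0" "q > 0" "coprime q d" "good_start a d F'"
    and bij: "bij_betw (lin x1 x2 y1 y2) (wedge 0 1 n m) (wedge 0 1 (a * q\<^sup>2) (1 + a * q * d))"
    and eqs: "A' = a * (q * x1 - d * y1)\<^sup>2" "B' = a * (q * x1 - d * y1) * (q * x2 - d * y2)"
      "C' = a * (q * x2 - d * y2)\<^sup>2"
      "D' = 2 * x1 - a * d * (q * x1 - d * y1)" "E' = 2 * x2 - a * d * (q * x2 - d * y2)"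
    by (rule L.normal_form[OF nm(3)])
  have evalN: "eval2 p (x, y) = eval2 (normal_poly a d q F') (of_int x1 * x + of_int x2 * y, of_int y1 * x + of_int y2 * y)" for x y
  proof -
    have "2 * eval2 p (x, y) = 2 * eval2 (normal_poly a d q F') (of_int x1 * x + of_int x2 * y, of_int y1 * x + of_int y2 * y)"
      unfolding eval eqs eval2_normal_poly by (simp add: algebra_simps power2_eq_square)
    then show ?thesis by simp
  qed
  have "a * q\<^sup>2 > 0" "1 + a * q * d > 0" using pos by (simp_all add: add_pos_pos)
  then have "packing_equivalent (of_int n / of_int m) p (of_int (a * q\<^sup>2) / of_int (1 + a * q * d)) (normal_poly a d q F')"
    by (rule packing_equivalent_transfer[OF nm(1,2) _ _ bij evalN disjI1[OF pack]])
  moreover have "normal_data a d q F'" using pos by (simp add: normal_data_def)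
  ultimately show ?thesis by (rule that[rotated])
qed

text \<open>Normal polynomials with \<open>q > 1\<close> lead to admissible triples. Those with
  \<open>q = 1\<close> live on integral sectors after a shear and give \<open>f_poly\<close> for
  \<open>d = 1\<close>, \<open>exc4_poly\<close> for \<open>d = 2\<close> and
  \<open>exc3_poly\<close> for \<open>d = 3\<close>.\<close>

lemma quadratic_packing_classification:
  assumes "\<alpha> > 0" "\<alpha> \<in> \<rat>" "quadratic_packing_polynomial \<alpha> p"
  shows "(\<exists>n m k f. admissible n m k \<and> packing_equivalent \<alpha> p (real n / real m) (p_poly n m k f)) \<or>
    (\<exists>n\<ge>1. packing_equivalent \<alpha> p (real n) (f_poly n) \<or> packing_equivalent \<alpha> p (real n) (g_poly n)) \<or>
    packing_equivalent \<alpha> p 3 exc3_poly \<or> packing_equivalent \<alpha> p 4 exc4_poly"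
proof -
  obtain n m where nm: "m > 0" "coprime n m" "\<alpha> = of_int n / of_int m"
    by (rule Rats_cases'[OF assms(2)])
  then have "n > 0" using assms(1) by (simp add: zero_less_divide_iff)
  obtain a d q f where data: "normal_data a d q f"
    and eq: "packing_equivalent \<alpha> p (of_int (a * q\<^sup>2) / of_int (1 + a * q * d)) (normal_poly a d q f)"
  proof (rule packing_equivalent_normal_poly[OF \<open>n > 0\<close> nm(1,2)])
    show "packing_polynomial (of_int n / of_int m) p" "total_degree2 p = 2"
      using assms(3) by (simp_all add: quadratic_packing_polynomial_def nm(3))
  qed (simp add: nm(3))
  show ?thesis
  proof (cases "q > 1")
    case True
    obtain n m k \<tau> where "admissible n m k" "int n = a * q\<^sup>2" "int m = 1 + a * q * d + \<tau> * int n" "int k = d"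
      using normal_data_admissible[OF data True] by blast
    moreover from this have "m > 0" by (simp add: admissible_def)
    ultimately show ?thesis
      using packing_equivalent_trans[OF eq p_poly_sheared[OF data, of n m \<tau> k]] by blast
  next
    case False
    then have q: "q = 1" using data by (simp add: normal_data_def)
    consider "d = 1" "f = 0" "a > 0" | "d = 2" "a = 4" "f = 1" | "d = 3" "a = 3" "f = 2"
      using data by (auto simp: normal_data_def good_start_def)
    then show ?thesis
    proof cases
      case 1
      have "packing_equivalent \<alpha> p (of_int a) (f_poly (nat a))"
        using eq f_poly_packing_equivalent[OF 1(3)] unfolding q 1(1,2) by (rule packing_equivalent_trans)
      moreover have "real_of_int a = real (nat a)" using 1 by simp
      ultimately have "packing_equivalent \<alpha> p (real (nat a)) (f_poly (nat a))" by (simp only:)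
      moreover have "nat a \<ge> 1" using 1 by simp
      ultimately have "\<exists>n\<ge>1. packing_equivalent \<alpha> p (real n) (f_poly n) \<or> packing_equivalent \<alpha> p (real n) (g_poly n)"
        by blast
      then show ?thesis by (intro disjI2[OF disjI1])
    next
      case 2
      have "packing_equivalent \<alpha> p (of_int a) exc4_poly"
        using eq exc4_poly_packing_equivalent unfolding q 2 by (rule packing_equivalent_trans)
      then show ?thesis using 2 by simp
    next
      case 3
      have "packing_equivalent \<alpha> p (of_int a) exc3_poly"
        using eq exc3_poly_packing_equivalent unfolding q 3 by (rule packing_equivalent_trans)
      then show ?thesis using 3 by simp
    qed
  qed
qed

theorem mainTheorem1:
  shows
    "(\<forall>n m k :: nat. admissible n m k \<longrightarrow>
        (\<exists>f :: real. quadratic_packing_polynomial (real n / real m) (p_poly n m k f))) \<and>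
     (\<forall>n :: nat. n \<ge> 1 \<longrightarrow>
        quadratic_packing_polynomial (real n) (f_poly n) \<and>
        quadratic_packing_polynomial (real n) (g_poly n)) \<and>
     quadratic_packing_polynomial 3 exc3_poly \<and>
     quadratic_packing_polynomial 4 exc4_poly \<and>
     (\<forall>(\<alpha> :: real) (p :: poly2).
        \<alpha> > 0 \<and> \<alpha> \<in> \<rat> \<and> quadratic_packing_polynomial \<alpha> p \<longrightarrow>
          (\<exists>(n :: nat) m k f. admissible n m k \<and>
             packing_equivalent \<alpha> p (real n / real m) (p_poly n m k f)) \<or>
          (\<exists>n :: nat. n \<ge> 1 \<and>
             (packing_equivalent \<alpha> p (real n) (f_poly n) \<or>
              packing_equivalent \<alpha> p (real n) (g_poly n))) \<or>
          packing_equivalent \<alpha> p 3 exc3_poly \<or>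
          packing_equivalent \<alpha> p 4 exc4_poly)"
proof (intro conjI)
  show "\<forall>n m k. admissible n m k \<longrightarrow>
      (\<exists>f. quadratic_packing_polynomial (real n / real m) (p_poly n m k f))"
    using quadratic_packing_p_poly by blast
  show "\<forall>n\<ge>1. quadratic_packing_polynomial (real n) (f_poly n) \<and>
      quadratic_packing_polynomial (real n) (g_poly n)"
    using quadratic_packing_f_poly quadratic_packing_g_poly by blast
  show "quadratic_packing_polynomial 3 exc3_poly"
    using exc3_poly_packing_equivalent total_degree2_quad2[of "3 / 2" 0 0 "- 7 / 2" 3 2]
    by (simp add: quadratic_packing_polynomial_def packing_equivalent_def exc3_poly_eq)
  show "quadratic_packing_polynomial 4 exc4_poly"
    using exc4_poly_packing_equivalent total_degree2_quad2[of 2 0 0 "- 3" 2 1]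
    by (simp add: quadratic_packing_polynomial_def packing_equivalent_def exc4_poly_eq)
  show "\<forall>\<alpha> p. \<alpha> > 0 \<and> \<alpha> \<in> \<rat> \<and> quadratic_packing_polynomial \<alpha> p \<longrightarrow>
      (\<exists>n m k f. admissible n m k \<and> packing_equivalent \<alpha> p (real n / real m) (p_poly n m k f)) \<or>
      (\<exists>n\<ge>1. packing_equivalent \<alpha> p (real n) (f_poly n) \<or> packing_equivalent \<alpha> p (real n) (g_poly n)) \<or>
      packing_equivalent \<alpha> p 3 exc3_poly \<or> packing_equivalent \<alpha> p 4 exc4_poly"
    by (intro allI impI, elim conjE, rule quadratic_packing_classification)
qed

end
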